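(* Let $\Phi:S\to S$ be an affine automorphism of the separable state space $S=S_{m,n}$. If $m\neq n$, there exist unique affine automorphisms $\psi_1:K_m\to K_m$ and $\psi_2:K_n\to K_n$ such that $\Phi=\psi_1\otimes\psi_2$, i.e. $\Phi(\omega\otimes\sigma)=\psi_1(\omega)\otimes\psi_2(\sigma)$ for all $\omega\in K_m,\sigma\in K_n$. If $m=n$, then either $\Phi=\psi_1\otimes\psi_2$ or $\Phi=\alpha_{m,m}\circ(\psi_1\otimes\psi_2)$, where $\psi_1,\psi_2$ are again unique affine automorphisms of $K_m$ and $K_n$ respectively.
   Context: $K_p$ is the state space of $\mathcal{B}(\mathbb{C}^p)$; $S_{m,n}$ is the convex set of separable states on $\mathcal{B}(\mathbb{C}^m\otimes\mathbb{C}^n)\cong\mathcal{B}(\mathbb{C}^m)\otimes\mathcal{B}(\mathbb{C}^n)$. For affine automorphisms $\psi_1$ of $K_m$ and $\psi_2$ of $K_n$, $\psi_1\otimes\psi_2$ denotes the tensor product of their unique linear extensions to the linear spans; it maps $S$ onto $S$. The swap automorphism $\alpha_{m,m}$ is the dual of the *-automorphism of $\mathcal{B}(\mathbb{C}^m)\otimes\mathcal{B}(\mathbb{C}^m)$ sending $A\otimes B\mapsto B\otimes A$; it satisfies $\alpha_{m,m}(\omega\otimes\sigma)=\sigma\otimes\omega$. *)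

theory Defs
  imports Complex_Main
begin

text \<open>Operators on C^p are represented by their matrices in the standard basis,
  as functions nat => nat => complex whose entries vanish outside {0..<p} x {0..<p}.
  A state on B(C^p) is identified with its density matrix.\<close>

type_synonym cmatrix = "nat \<Rightarrow> nat \<Rightarrow> complex"

definition supported :: "nat \<Rightarrow> cmatrix \<Rightarrow> bool" where
  "supported p A \<longleftrightarrow> (\<forall>i j. \<not> (i < p \<and> j < p) \<longrightarrow> A i j = 0)"

definition quad_form :: "nat \<Rightarrow> cmatrix \<Rightarrow> (nat \<Rightarrow> complex) \<Rightarrow> complex" where
  "quad_form p A v = (\<Sum>i<p. \<Sum>j<p. cnj (v i) * A i j * v j)"

definition positive_op :: "nat \<Rightarrow> cmatrix \<Rightarrow> bool" where
  "positive_op p A \<longleftrightarrow> (\<forall>v. quad_form p A v \<in> \<real> \<and> 0 \<le> Re (quad_form p A v))"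

definition mtrace :: "nat \<Rightarrow> cmatrix \<Rightarrow> complex" where
  "mtrace p A = (\<Sum>i<p. A i i)"

definition K :: "nat \<Rightarrow> cmatrix set" where
  "K p = {A. supported p A \<and> positive_op p A \<and> mtrace p A = 1}"

text \<open>Kronecker product, C^m (x) C^n = C^(m*n), index (i,k) |-> i*n + k.\<close>
definition tensor :: "nat \<Rightarrow> nat \<Rightarrow> cmatrix \<Rightarrow> cmatrix \<Rightarrow> cmatrix" where
  "tensor m n A B = (\<lambda>i j. if i < m * n \<and> j < m * n
       then A (i div n) (j div n) * B (i mod n) (j mod n) else 0)"

definition S :: "nat \<Rightarrow> nat \<Rightarrow> cmatrix set" where
  "S m n = {r. \<exists>k c \<omega> \<sigma>.
      (\<forall>l<(k::nat). 0 \<le> (c l :: real) \<and> \<omega> l \<in> K m \<and> \<sigma> l \<in> K n) \<and> (\<Sum>l<k. c l) = 1 \<and>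
      r = (\<lambda>i j. (\<Sum>l<k. complex_of_real (c l) * tensor m n (\<omega> l) (\<sigma> l) i j)) }"

definition cconv :: "real \<Rightarrow> cmatrix \<Rightarrow> cmatrix \<Rightarrow> cmatrix" where
  "cconv t A B = (\<lambda>i j. complex_of_real t * A i j + complex_of_real (1 - t) * B i j)"

definition affine_aut :: "cmatrix set \<Rightarrow> (cmatrix \<Rightarrow> cmatrix) \<Rightarrow> bool" where
  "affine_aut C f \<longleftrightarrow> bij_betw f C C \<and>
     (\<forall>x\<in>C. \<forall>y\<in>C. \<forall>t. 0 \<le> t \<and> t \<le> 1 \<longrightarrow> f (cconv t x y) = cconv t (f x) (f y))"

end

theory Submission
  imports Defs
begin

text \<open>The separable states are the convex hull of the pure product states, which are exactly the
  extreme points; hence an affine automorphism permutes the pure product states. Two distinct pure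
  product states that share a factor span a face containing further extreme points (superpose the
  differing factors), whereas the face spanned by two that differ in both factors is a segment.
  So the permutation preserves the relation of sharing a factor, i.e. it is a collineation of the
  grid formed by the pure states of the two systems, and such a map is a product map or a product
  map followed by the swap. It extends affinely to mixed states through partial traces. The swapped
  case forces K m and K n to be affinely isomorphic, hence m = n.\<close>

section \<open>Binary convex hulls and affine isomorphisms\<close>

text \<open>Separable states are given as finite mixtures, not by inequalities, whereas affinity of
  a map is stated for two-point mixtures only. The hull is therefore generated by two-point mixing,
  so that facts stable under mixing follow by rule induction from the generators. Inequalities come
  back as test forms: a form that is nonnegative on all separable states and vanishes on a proper
  mixture vanishes on both ingredients, so its zeros confine faces. Faces enter only through
  \<open>extreme\<close> and \<open>linked\<close>, which mention nothing but mixtures and hence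
  travel along any affine bijection. The comparison of rows in the grid is a pigeonhole on three
  columns; a one-dimensional system has a single pure state, so it is treated apart. The swapped
  case needs no second argument: composed with \<open>tswap\<close> it becomes a product map from
  the system (m, n) to the system (n, m), which is why affine bijections between different sets are
  carried along.\<close>

inductive_set chull :: "cmatrix set \<Rightarrow> cmatrix set" for X where
  base: "x \<in> X \<Longrightarrow> x \<in> chull X"
| mix: "\<lbrakk>x \<in> chull X; y \<in> chull X; 0 \<le> t; t \<le> 1\<rbrakk> \<Longrightarrow> cconv t x y \<in> chull X"

definition mixable :: "cmatrix set \<Rightarrow> bool" where
  "mixable C \<longleftrightarrow> (\<forall>x\<in>C. \<forall>y\<in>C. \<forall>t. 0 \<le> t \<and> t \<le> 1 \<longrightarrow> cconv t x y \<in> C)"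

lemma chull_subset: "X \<subseteq> C \<Longrightarrow> mixable C \<Longrightarrow> chull X \<subseteq> C"
  by (rule subsetI, erule chull.induct) (auto simp: mixable_def)

lemma cconv_0 [simp]: "cconv 0 x y = y"
  and cconv_1 [simp]: "cconv 1 x y = x"
  and cconv_same [simp]: "cconv t x x = x"
  by (simp_all add: cconv_def algebra_simps)

text \<open>Split off the last term and rescale the others by \<open>1 - c k\<close>. The rescaling
  fails exactly when the last weight is 1, and then all other terms vanish.\<close>

lemma chull_sum:
  assumes "\<forall>l<(k::nat). 0 \<le> (c l :: real) \<and> x l \<in> chull X" and "(\<Sum>l<k. c l) = 1"
  shows "(\<lambda>i j. \<Sum>l<k. complex_of_real (c l) * x l i j) \<in> chull X"
  using assms
proof (induction k arbitrary: c)
  case 0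
  then show ?case by simp
next
  case (Suc k)
  have nn: "0 \<le> (\<Sum>l<k. c l)"
    by (rule sum_nonneg) (use Suc.prems in auto)
  have sum: "(\<Sum>l<k. c l) = 1 - c k"
    using Suc.prems(2) by simp
  show ?case
  proof (cases "c k = 1")
    case True
    then have "(\<Sum>l<k. c l) = 0" using sum by simp
    then have "\<forall>l<k. c l = 0"
      using Suc.prems(1) by (subst (asm) sum_nonneg_eq_0_iff) auto
    then have "(\<lambda>i j. \<Sum>l<Suc k. complex_of_real (c l) * x l i j) = x k"
      using True by simp
    then show ?thesis using Suc.prems(1) by simp
  next
    case False
    let ?s = "1 - c k"
    let ?y = "\<lambda>i j. \<Sum>l<k. complex_of_real (c l / ?s) * x l i j"
    have s: "?s > 0" using nn sum False by simp
    have "?y \<in> chull X"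
    proof (rule Suc.IH)
      show "\<forall>l<k. 0 \<le> c l / ?s \<and> x l \<in> chull X"
        using Suc.prems(1) s by simp
      show "(\<Sum>l<k. c l / ?s) = 1"
        using s sum by (simp flip: sum_divide_distrib)
    qed
    moreover have "x k \<in> chull X" "0 \<le> c k" using Suc.prems(1) by auto
    ultimately have "cconv ?s ?y (x k) \<in> chull X"
      using s by (intro chull.mix) auto
    moreover have scale: "complex_of_real ?s * (complex_of_real (c l / ?s) * z)
        = complex_of_real (c l) * z" for l z
      using s by (simp del: of_real_diff)
    have "cconv ?s ?y (x k) = (\<lambda>i j. \<Sum>l<Suc k. complex_of_real (c l) * x l i j)"
      unfolding cconv_def by (simp add: scale sum_distrib_left del: of_real_diff of_real_divide)
    ultimately show ?thesis by simp
  qed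
qed

section \<open>Extreme points, faces and their transport along affine bijections\<close>

definition extreme :: "cmatrix set \<Rightarrow> cmatrix \<Rightarrow> bool" where
  "extreme C x \<longleftrightarrow> x \<in> C \<and>
     (\<forall>y\<in>C. \<forall>z\<in>C. \<forall>t. 0 < t \<and> t < 1 \<and> x = cconv t y z \<longrightarrow> y = x \<and> z = x)"

text \<open>For extreme points, this says that the face generated by them is more than a segment
  (or that they coincide).\<close>

definition linked :: "cmatrix set \<Rightarrow> cmatrix \<Rightarrow> cmatrix \<Rightarrow> bool" where
  "linked C x y \<longleftrightarrow> x = y \<or>
     (\<exists>z u t. extreme C z \<and> z \<noteq> x \<and> z \<noteq> y \<and> u \<in> C \<and> 0 < t \<and> t < 1 \<and>
        cconv (1/2) x y = cconv t z u)"

text \<open>An extreme point that arises as a proper mixture equals its ingredients, so its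
  derivation can be followed down to a generator.\<close>

lemma extreme_chull_in_generators: "x \<in> chull X \<Longrightarrow> extreme (chull X) x \<Longrightarrow> x \<in> X"
proof (induction rule: chull.induct)
  case (mix x y t)
  show ?case
  proof (cases "t = 0 \<or> t = 1")
    case False
    then have "x = cconv t x y \<and> y = cconv t x y"
      using mix unfolding extreme_def by (metis order_le_less)
    then show ?thesis using mix by metis
  qed (use mix in auto)
qed

definition affine_iso :: "cmatrix set \<Rightarrow> cmatrix set \<Rightarrow> (cmatrix \<Rightarrow> cmatrix) \<Rightarrow> bool" where
  "affine_iso C D f \<longleftrightarrow> bij_betw f C D \<and>
     (\<forall>x\<in>C. \<forall>y\<in>C. \<forall>t. 0 \<le> t \<and> t \<le> 1 \<longrightarrow> f (cconv t x y) = cconv t (f x) (f y))"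

lemma affine_aut_iff_iso: "affine_aut C f \<longleftrightarrow> affine_iso C C f"
  by (simp add: affine_aut_def affine_iso_def)

lemma affine_isoD:
  assumes "affine_iso C D f"
  shows "x \<in> C \<Longrightarrow> f x \<in> D"
    and "x \<in> C \<Longrightarrow> y \<in> C \<Longrightarrow> f x = f y \<longleftrightarrow> x = y"
    and "x \<in> C \<Longrightarrow> y \<in> C \<Longrightarrow> 0 \<le> t \<Longrightarrow> t \<le> 1 \<Longrightarrow> f (cconv t x y) = cconv t (f x) (f y)"
    and "z \<in> D \<Longrightarrow> \<exists>x\<in>C. f x = z"
  using assms unfolding affine_iso_def bij_betw_def by (auto dest: inj_onD)

lemma affine_iso_extreme:
  assumes f: "affine_iso C D f" and C: "mixable C" and x: "extreme C x"
  shows "extreme D (f x)"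
  unfolding extreme_def
proof (intro conjI[OF _ ballI] ballI allI impI)
  show "f x \<in> D" using x f by (auto simp: extreme_def affine_isoD)
next
  fix y z t
  assume D: "y \<in> D" "z \<in> D" and t: "0 < t \<and> t < 1 \<and> f x = cconv t y z"
  then obtain y' z' where *: "y' \<in> C" "f y' = y" "z' \<in> C" "f z' = z"
    using affine_isoD(4)[OF f] by metis
  then have "f x = f (cconv t y' z')" "cconv t y' z' \<in> C"
    using t C by (auto simp: affine_isoD(3)[OF f] mixable_def)
  then have "x = cconv t y' z'"
    using x by (simp add: extreme_def affine_isoD(2)[OF f])
  then have "y' = x \<and> z' = x"
    using x * t unfolding extreme_def by blast
  then show "y = f x \<and> z = f x" using * by simp
qed

lemma affine_iso_linked:
  assumes f: "affine_iso C D f" and C: "mixable C" and xy: "x \<in> C" "y \<in> C"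
    and l: "linked C x y"
  shows "linked D (f x) (f y)"
proof (cases "x = y")
  case False
  then obtain z u t where *: "extreme C z" "z \<noteq> x" "z \<noteq> y" "u \<in> C" "0 < t" "t < 1"
      "cconv (1/2) x y = cconv t z u"
    using l unfolding linked_def by blast
  have z: "z \<in> C" using * by (simp add: extreme_def)
  have "cconv (1/2) (f x) (f y) = cconv t (f z) (f u)"
    using * z xy by (simp flip: affine_isoD(3)[OF f])
  then show ?thesis
    unfolding linked_def using * z xy affine_iso_extreme[OF f C *(1)]
    by (metis affine_isoD(1,2)[OF f])
qed (simp add: linked_def)

lemma affine_iso_inv:
  assumes f: "affine_iso C D f" and C: "mixable C"
  shows "affine_iso D C (inv_into C f)"
  unfolding affine_iso_def
proof (intro conjI ballI allI impI)
  have bij: "bij_betw f C D" using f by (simp add: affine_iso_def)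
  then show "bij_betw (inv_into C f) D C" by (rule bij_betw_inv_into)
  fix x y and t :: real
  assume D: "x \<in> D" "y \<in> D" and t: "0 \<le> t \<and> t \<le> 1"
  let ?g = "inv_into C f"
  have g: "?g x \<in> C" "?g y \<in> C" "f (?g x) = x" "f (?g y) = y"
    using D bij by (auto simp: bij_betw_def inv_into_into f_inv_into_f)
  have "f (cconv t (?g x) (?g y)) = cconv t x y"
    using g t by (simp add: affine_isoD(3)[OF f])
  moreover have "cconv t (?g x) (?g y) \<in> C"
    using g t C by (simp add: mixable_def)
  ultimately show "?g (cconv t x y) = cconv t (?g x) (?g y)"
    using bij by (metis bij_betw_inv_into_left)
qed

lemma affine_iso_linked_iff:
  assumes f: "affine_iso C D f" and C: "mixable C" and D: "mixable D" and xy: "x \<in> C" "y \<in> C"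
  shows "linked D (f x) (f y) \<longleftrightarrow> linked C x y"
proof
  assume l: "linked D (f x) (f y)"
  have "bij_betw f C D" using f by (simp add: affine_iso_def)
  then have "inv_into C f (f x) = x" "inv_into C f (f y) = y"
    using xy by (auto simp: bij_betw_inv_into_left)
  then show "linked C x y"
    using affine_iso_linked[OF affine_iso_inv[OF f C] D _ _ l] xy affine_isoD(1)[OF f] by simp
qed (rule affine_iso_linked[OF f C xy])

section \<open>Collineations of a grid\<close>

text \<open>\<open>F\<close> and \<open>G\<close> are the two coordinates of the image, and points
  are collinear if they share a coordinate. Each row goes into a line, the lines of all rows have
  the same direction, and the remaining coordinate then depends on the column alone.\<close>

lemma grid_collineation_product_or_swap:
  assumes coll: "\<And>x x' y y'. \<lbrakk>x \<in> X; x' \<in> X; y \<in> Y; y' \<in> Y\<rbrakk> \<Longrightarrow>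
        (F x y = F x' y' \<or> G x y = G x' y') \<longleftrightarrow> (x = x' \<or> y = y')"
    and inj: "\<And>x x' y y'. \<lbrakk>x \<in> X; x' \<in> X; y \<in> Y; y' \<in> Y; F x y = F x' y'; G x y = G x' y'\<rbrakk>
        \<Longrightarrow> x = x' \<and> y = y'"
    and Y: "a \<in> Y" "b \<in> Y" "c \<in> Y" "a \<noteq> b" "a \<noteq> c" "b \<noteq> c"
  shows "(\<forall>x\<in>X. \<forall>x'\<in>X. \<forall>y\<in>Y. \<forall>y'\<in>Y. F x y = F x y' \<and> G x y = G x' y) \<or>
         (\<forall>x\<in>X. \<forall>x'\<in>X. \<forall>y\<in>Y. \<forall>y'\<in>Y. G x y = G x y' \<and> F x y = F x' y)"
proof -
  have row: "(\<forall>y\<in>Y. F x y = F x a) \<or> (\<forall>y\<in>Y. G x y = G x a)" if x: "x \<in> X" for x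
  proof (rule ccontr)
    assume "\<not> ?thesis"
    \<comment> \<open>The images of \<open>y\<close> and \<open>z\<close> must be collinear, yet
      \<open>y\<close> keeps only the second coordinate of \<open>a\<close> and \<open>z\<close>
      only the first.\<close>
    then obtain y z where "y \<in> Y" "z \<in> Y" "F x y \<noteq> F x a" "G x z \<noteq> G x a" by blast
    then show False using coll[OF x x] inj[OF x x] Y(1) by metis
  qed
  have mixed: False
    if x: "x \<in> X" "x' \<in> X" and F: "\<forall>y\<in>Y. F x y = F x a" and G: "\<forall>y\<in>Y. G x' y = G x' a" for x x'
  proof -
    have *: "F x a = F x' y \<or> G x y = G x' a" if "y \<in> Y" for y
      using coll[OF x that that] F G that by metis
    have 1: "y = y'" if "y \<in> Y" "y' \<in> Y" "F x' y = F x' y'" for y y'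
      using inj[OF x(2) x(2) that(1,2)] that G by metis
    have 2: "y = y'" if "y \<in> Y" "y' \<in> Y" "G x y = G x y'" for y y'
      using inj[OF x(1) x(1) that(1,2)] that F by metis
    \<comment> \<open>Pigeonhole: by injectivity each alternative in \<open>*\<close> holds for at
      most one column, but there are three.\<close>
    show False
      using *[OF Y(1)] *[OF Y(2)] *[OF Y(3)] 1 2 Y by metis
  qed
  have half: "\<forall>x\<in>X. \<forall>x'\<in>X. \<forall>y\<in>Y. \<forall>y'\<in>Y. f x y = f x y' \<and> g x y = g x' y"
    if f: "\<forall>x\<in>X. \<forall>y\<in>Y. f x y = f x a"
      and c: "\<And>x x' y y'. \<lbrakk>x \<in> X; x' \<in> X; y \<in> Y; y' \<in> Y\<rbrakk> \<Longrightarrow>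
        (f x y = f x' y' \<or> g x y = g x' y') \<longleftrightarrow> (x = x' \<or> y = y')" for f g
  proof (intro ballI conjI)
    fix x x' y y' assume *: "x \<in> X" "x' \<in> X" "y \<in> Y" "y' \<in> Y"
    show "f x y = f x y'" using f * by metis
    show "g x y = g x' y"
    proof (cases "x = x'")
      case False
      \<comment> \<open>A second column separates the rows: since \<open>f\<close> is constant on
        rows, equal values would make (x, y) collinear with (x', y'').\<close>
      obtain y'' where "y'' \<in> Y" "y'' \<noteq> y" using Y by metis
      then have "f x y \<noteq> f x' y" using c[of x x' y y''] f * False by metis
      then show ?thesis using c[of x x' y y] * by metis
    qed simp
  qed
  show ?thesis
  proof (cases "\<forall>x\<in>X. \<forall>y\<in>Y. F x y = F x a")
    case True
    then show ?thesis using half[of F G] coll by blast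
  next
    case False
    then have "\<forall>x\<in>X. \<forall>y\<in>Y. G x y = G x a" using row mixed by metis
    moreover have "(G x y = G x' y' \<or> F x y = F x' y') \<longleftrightarrow> (x = x' \<or> y = y')"
      if "x \<in> X" "x' \<in> X" "y \<in> Y" "y' \<in> Y" for x x' y y'
      using coll[OF that] by blast
    ultimately show ?thesis using half[of G F] by blast
  qed
qed

section \<open>Density matrices and pure states\<close>

definition cinner :: "nat \<Rightarrow> (nat \<Rightarrow> complex) \<Rightarrow> (nat \<Rightarrow> complex) \<Rightarrow> complex" where
  "cinner p a v = (\<Sum>i<p. cnj (a i) * v i)"

definition proj :: "nat \<Rightarrow> (nat \<Rightarrow> complex) \<Rightarrow> cmatrix" where
  "proj p v = (\<lambda>i j. if i < p \<and> j < p then v i * cnj (v j) else 0)"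

definition pure :: "nat \<Rightarrow> cmatrix set" where
  "pure p = proj p ` {v. cinner p v v = 1}"

lemma cinner_cnj: "cnj (cinner p a v) = cinner p v a"
  by (simp add: cinner_def mult.commute)

lemma cinner_self: "cinner p v v = complex_of_real (\<Sum>i<p. (cmod (v i))\<^sup>2)"
  unfolding cinner_def of_real_sum
  by (intro sum.cong refl) (simp add: complex_norm_square mult.commute del: of_real_power)

lemma cinner_self_eq_0_iff: "cinner p v v = 0 \<longleftrightarrow> (\<forall>i<p. v i = 0)"
proof -
  have "(\<Sum>i<p. (cmod (v i))\<^sup>2) = 0 \<longleftrightarrow> (\<forall>i<p. v i = 0)"
    by (subst sum_nonneg_eq_0_iff) auto
  then show ?thesis by (simp only: cinner_self of_real_eq_0_iff)
qed

lemma cinner_diff_scale_right: "cinner p a (\<lambda>i. u i - c * v i) = cinner p a u - c * cinner p a v"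
  by (simp add: cinner_def algebra_simps sum_subtractf sum_distrib_left)

lemma cinner_scale: "cinner p (\<lambda>i. c * v i) (\<lambda>i. d * w i) = cnj c * d * cinner p v w"
  by (simp add: cinner_def algebra_simps sum_distrib_left)

lemma quad_form_proj: "quad_form p (proj p v) a = complex_of_real ((cmod (cinner p a v))\<^sup>2)"
proof -
  have "quad_form p (proj p v) a = (\<Sum>i<p. \<Sum>j<p. (cnj (a i) * v i) * (cnj (v j) * a j))"
    unfolding quad_form_def proj_def by (intro sum.cong refl) simp
  also have "\<dots> = cinner p a v * cinner p v a"
    by (simp add: cinner_def sum_product)
  also have "\<dots> = cinner p a v * cnj (cinner p a v)"
    by (simp only: cinner_cnj)
  finally show ?thesis by (simp add: complex_norm_square del: of_real_power)
qed

lemma quad_form_cconv: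
  "quad_form p (cconv t A B) v
     = complex_of_real t * quad_form p A v + complex_of_real (1 - t) * quad_form p B v"
  unfolding quad_form_def cconv_def
  by (simp add: algebra_simps sum.distrib sum_distrib_left sum_subtractf)

text \<open>The factor between two unit vectors is a phase, which cancels in
  \<open>v i * cnj (v j)\<close>.\<close>

lemma unit_parallel:
  assumes u: "cinner p u u = 1" and v: "cinner p v v = 1" and c: "\<forall>i<p. u i = c * v i"
  shows "proj p u = proj p v"
proof -
  have "cinner p u u = cinner p (\<lambda>i. c * v i) (\<lambda>i. c * v i)"
    using c by (simp add: cinner_def)
  then have "c * cnj c = 1" using u v by (simp add: cinner_scale mult.commute)
  then have "c * v i * cnj (c * v j) = v i * cnj (v j)" for i j
    by (metis (no_types, lifting) complex_cnj_mult mult.assoc mult.commute mult.left_neutral)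
  then show ?thesis using c by (auto simp: proj_def fun_eq_iff)
qed

text \<open>Apply both rank-one matrices to the vector \<open>u\<close>.\<close>

lemma proj_eq_parallel:
  assumes u: "cinner p u u = 1" and eq: "proj p u = proj p v"
  shows "\<forall>i<p. u i = cinner p v u * v i"
proof (intro allI impI)
  fix i assume i: "i < p"
  have "u i * cinner p u u = (\<Sum>j<p. proj p u i j * u j)"
    using i by (simp add: cinner_def proj_def sum_distrib_left mult.assoc)
  also have "\<dots> = (\<Sum>j<p. proj p v i j * u j)" using eq by simp
  also have "\<dots> = cinner p v u * v i"
    using i by (simp add: cinner_def proj_def sum_distrib_left sum_distrib_right mult_ac)
  finally show "u i = cinner p v u * v i" using u by simp
qed

text \<open>The test vector is the component of \<open>u\<close> orthogonal to \<open>v\<close>; the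
  hypothesis forces its norm to be 0. This turns zeros of test forms into equality of pure
  states.\<close>

lemma proj_eq_if_annihilated:
  assumes u: "cinner p u u = 1" and v: "cinner p v v = 1"
    and ann: "\<And>a. cinner p a v = 0 \<Longrightarrow> cinner p a u = 0"
  shows "proj p u = proj p v"
proof -
  let ?a = "\<lambda>i. u i - cinner p v u * v i"
  have "cinner p v ?a = 0" by (simp add: cinner_diff_scale_right v)
  then have av: "cinner p ?a v = 0" by (metis cinner_cnj complex_cnj_zero)
  then have "cinner p ?a ?a = 0"
    using ann[OF av] by (simp add: cinner_diff_scale_right)
  then have "\<forall>i<p. u i = cinner p v u * v i"
    by (simp add: cinner_self_eq_0_iff)
  then show ?thesis by (rule unit_parallel[OF u v])
qed

lemma proj_in_K: "cinner p v v = 1 \<Longrightarrow> proj p v \<in> K p"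
  by (auto simp: K_def supported_def positive_op_def quad_form_proj mtrace_def)
    (auto simp: proj_def cinner_def mult.commute)

lemma mixable_K: "mixable (K p)"
  unfolding mixable_def
proof (intro ballI allI impI)
  fix A B and t :: real
  assume A: "A \<in> K p" and B: "B \<in> K p" and t: "0 \<le> t \<and> t \<le> 1"
  have "positive_op p (cconv t A B)"
    using A B t unfolding positive_op_def K_def
    by (auto simp: quad_form_cconv simp del: of_real_diff intro!: Reals_add Reals_mult)
  moreover have "mtrace p (cconv t A B) = of_real t * mtrace p A + of_real (1 - t) * mtrace p B"
    by (simp add: mtrace_def cconv_def sum.distrib sum_distrib_left del: of_real_diff)
  ultimately show "cconv t A B \<in> K p"
    using A B by (auto simp: K_def supported_def cconv_def)
qed

section \<open>Positive matrices as sums of rank-one matrices\<close>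

lemma quad_form_upd:
  "quad_form (Suc k) A (v(k := c)) = quad_form k A v + cnj c * (\<Sum>j<k. A k j * v j)
     + c * (\<Sum>i<k. cnj (v i) * A i k) + cnj c * c * A k k"
proof -
  have "quad_form (Suc k) A (v(k := c)) =
     (\<Sum>i<k. (\<Sum>j<k. cnj (v i) * A i j * v j) + cnj (v i) * A i k * c)
      + ((\<Sum>j<k. cnj c * A k j * v j) + cnj c * A k k * c)"
    unfolding quad_form_def by simp
  then show ?thesis
    by (simp add: quad_form_def sum.distrib sum_distrib_left algebra_simps)
qed

lemma quad_form_basis:
  assumes "i < p" shows "quad_form p A (\<lambda>j. if j = i then 1 else 0) = A i i"
  using assms by (simp add: quad_form_def if_distrib[of cnj] if_distrib[of "\<lambda>x. x * _"]
      if_distrib[of "\<lambda>x. _ * x"] sum.delta cong: if_cong)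

text \<open>The form is evaluated at the i-th basis vector plus \<open>c\<close> times the last one.
  Suitable values of \<open>c\<close> give Hermitian symmetry and the vanishing of a column under a
  zero corner.\<close>

lemma positive_op_upd:
  assumes "positive_op (Suc k) A" and i: "i < k"
  shows "A i i + cnj c * A k i + c * A i k + cnj c * c * A k k \<in> \<real>"
    and "0 \<le> Re (A i i + cnj c * A k i + c * A i k + cnj c * c * A k k)"
proof -
  let ?e = "\<lambda>j. if j = i then 1 else 0 :: complex"
  have "quad_form k A ?e = A i i" using i by (rule quad_form_basis)
  moreover have "(\<Sum>j<k. A k j * ?e j) = A k i" "(\<Sum>j<k. cnj (?e j) * A j k) = A i k"
    using i by (simp_all add: if_distrib[of cnj] if_distrib[of "\<lambda>x. x * _"]
        if_distrib[of "\<lambda>x. _ * x"] sum.delta cong: if_cong)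
  ultimately have "quad_form (Suc k) A (?e(k := c))
      = A i i + cnj c * A k i + c * A i k + cnj c * c * A k k"
    by (simp only: quad_form_upd)
  then show "A i i + cnj c * A k i + c * A i k + cnj c * c * A k k \<in> \<real>"
    and "0 \<le> Re (A i i + cnj c * A k i + c * A i k + cnj c * c * A k k)"
    using assms(1) unfolding positive_op_def by metis+
qed

lemma positive_op_diag:
  assumes "positive_op (Suc k) A"
  shows "A k k \<in> \<real>" and "0 \<le> Re (A k k)"
proof -
  have "quad_form (Suc k) A ((\<lambda>_. 0)(k := 1)) = A k k"
    unfolding quad_form_upd by (simp add: quad_form_def)
  then show "A k k \<in> \<real>" "0 \<le> Re (A k k)"
    using assms unfolding positive_op_def by metis+
qed

text \<open>Reality at \<open>c = 1\<close> makes the imaginary parts of the two entries opposite;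
  at \<open>c = \<i>\<close> it makes their real parts equal.\<close>

lemma positive_op_hermitian:
  assumes pos: "positive_op (Suc k) A" and i: "i < k"
  shows "A k i = cnj (A i k)"
proof -
  have "Im (A i i) = 0" using positive_op_upd(1)[OF assms, of 0] by (simp add: complex_is_Real_iff)
  moreover have "Im (A k k) = 0" using positive_op_diag[OF pos] by (simp add: complex_is_Real_iff)
  ultimately show ?thesis
    using positive_op_upd(1)[OF assms, of 1] positive_op_upd(1)[OF assms, of \<i>]
    by (simp add: complex_is_Real_iff complex_eq_iff)
qed

lemma positive_op_zero_diag:
  assumes pos: "positive_op (Suc k) A" and i: "i < k" and z: "A k k = 0"
  shows "A i k = 0"
proof (rule ccontr)
  assume nz: "A i k \<noteq> 0"
  let ?r = "(cmod (A i k))\<^sup>2"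
  \<comment> \<open>With a zero corner the form has no quadratic term in \<open>c\<close>, so a
    large multiple of \<open>cnj (A i k)\<close> drives it below 0; this size gives exactly
    \<open>- Re (A i i) - 2\<close>.\<close>
  let ?M = "(Re (A i i) + 1) / ?r"
  have r: "?r > 0" using nz by simp
  have "Re (A i i + cnj (- ?M * cnj (A i k)) * A k i + (- ?M * cnj (A i k)) * A i k)
      = Re (A i i) - 2 * (?M * ?r)"
    unfolding positive_op_hermitian[OF pos i] cmod_power2
    by (simp add: power2_eq_square algebra_simps)
  also have "\<dots> = - Re (A i i) - 2" using r by simp
  finally have "0 \<le> - Re (A i i) - 2"
    using positive_op_upd(2)[OF pos i, of "- ?M * cnj (A i k)"] z by simp
  moreover have "0 \<le> Re (A i i)" using positive_op_upd(2)[OF pos i, of 0] by simp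
  ultimately show False by simp
qed

text \<open>Cholesky decomposition, eliminating the last coordinate first: the Schur complement of the
  last diagonal entry is again positive by completing the square.\<close>

lemma positive_op_sum_proj:
  assumes "supported p A" and "positive_op p A"
  shows "\<exists>u. A = (\<lambda>i j. \<Sum>l<p. proj p (u l) i j)"
  using assms
proof (induction p arbitrary: A)
  case 0
  then show ?case by (auto simp: supported_def)
next
  case (Suc k)
  note pos = \<open>positive_op (Suc k) A\<close>
  have d: "A k k \<in> \<real>" "0 \<le> Re (A k k)" using positive_op_diag[OF pos] .
  define d where "d = Re (A k k)"
  have Ad: "A k k = complex_of_real d" and d0: "0 \<le> d" using d by (simp_all add: d_def)
  have herm: "A k i = cnj (A i k)" if "i < k" for i
    using positive_op_hermitian[OF pos that] .
  \<comment> \<open>The last column divided by the root of the corner, so that \<open>w k\<close> is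
    \<open>sqrt d\<close>. If \<open>d = 0\<close>, division by zero makes \<open>w\<close> vanish,
    in accordance with \<open>zero\<close> below.\<close>
  define w where "w i = (if i \<le> k then A i k / complex_of_real (sqrt d) else 0)" for i
  define B where "B i j = (if i < k \<and> j < k then A i j - w i * cnj (w j) else 0)" for i j
  have zero: "A i k = 0" if "d = 0" "i < k" for i
    using positive_op_zero_diag[OF pos that(2)] Ad that(1) by simp
  have split: "A i j = B i j + proj (Suc k) w i j" for i j
  proof -
    consider "i < k" "j < k" | "i = k" "j = k" | "i = k" "j < k" | "i < k" "j = k"
      | "i > k \<or> j > k" by linarith
    then show ?thesis
    proof cases
      case 2
      then show ?thesis using d0 by (simp add: B_def proj_def w_def Ad flip: of_real_mult of_real_divide)
    next
      case 3
      then show ?thesis using d0 herm[of j] zero[of j]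
        by (cases "d = 0") (auto simp: B_def proj_def w_def Ad
            simp flip: of_real_mult)
    next
      case 4
      then show ?thesis using d0 herm[of i] zero[of i]
        by (cases "d = 0") (auto simp: B_def proj_def w_def Ad simp flip: of_real_mult)
    next
      case 5
      then show ?thesis using Suc.prems(1) by (auto simp: B_def proj_def supported_def)
    qed (simp add: B_def proj_def)
  qed
  have "positive_op k B"
    unfolding positive_op_def
  proof
    fix v
    define s where "s = (\<Sum>j<k. A k j * v j)"
    \<comment> \<open>The last coordinate that minimises the form for given \<open>v\<close>; the
      minimum is the value of the Schur complement. If \<open>d = 0\<close>, then
      \<open>c = 0\<close> and the subtracted term is 0 too.\<close>
    define c where "c = - s / complex_of_real d"
    have s': "(\<Sum>i<k. cnj (v i) * A i k) = cnj s"
      by (simp add: s_def herm mult.commute)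
    have "quad_form k B v = quad_form k A v - (\<Sum>i<k. \<Sum>j<k. (cnj (v i) * w i) * (cnj (w j) * v j))"
      unfolding quad_form_def sum_subtractf[symmetric]
      by (intro sum.cong refl) (simp add: B_def algebra_simps)
    also have "(\<Sum>i<k. \<Sum>j<k. (cnj (v i) * w i) * (cnj (w j) * v j))
        = (cnj s / complex_of_real (sqrt d)) * (s / complex_of_real (sqrt d))"
    proof -
      have "(\<Sum>i<k. cnj (v i) * w i) = cnj s / complex_of_real (sqrt d)"
        by (simp add: w_def flip: s' sum_divide_distrib)
      moreover have "(\<Sum>j<k. cnj (w j) * v j) = s / complex_of_real (sqrt d)"
        by (simp add: w_def s_def herm sum_divide_distrib)
      ultimately show ?thesis by (simp flip: sum_product)
    qed
    also have "\<dots> = cnj s * s / complex_of_real d"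
      using d(2) by (simp add: d_def flip: of_real_mult)
    also have "quad_form k A v - cnj s * s / complex_of_real d = quad_form (Suc k) A (v(k := c))"
    proof (cases "d = 0")
      case True
      then show ?thesis
        unfolding quad_form_upd s' s_def[symmetric] using Ad by (simp add: c_def)
    next
      case False
      then show ?thesis
        unfolding quad_form_upd s' s_def[symmetric] Ad by (simp add: c_def field_simps)
    qed
    finally show "quad_form k B v \<in> \<real> \<and> 0 \<le> Re (quad_form k B v)"
      using pos unfolding positive_op_def by metis
  qed
  moreover have "supported k B" by (simp add: supported_def B_def)
  ultimately obtain u where u: "B = (\<lambda>i j. \<Sum>l<k. proj k (u l) i j)"
    using Suc.IH by blast
  \<comment> \<open>\<open>proj k\<close> never reads \<open>u l k\<close>, which may be anything;
    it is set to 0 before the dimension is raised.\<close>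
  define u' where "u' l = (if l = k then w else (\<lambda>i. if i < k then u l i else 0))" for l
  have "proj k (u l) = proj (Suc k) (u' l)" if "l < k" for l
    using that by (auto simp: proj_def u'_def fun_eq_iff)
  then have "A = (\<lambda>i j. \<Sum>l<Suc k. proj (Suc k) (u' l) i j)"
    by (intro ext) (simp add: split u, simp add: u'_def)
  then show ?case by blast
qed

lemma cinner_normalize:
  assumes "(\<Sum>i<p. (cmod (v i))\<^sup>2) = r" and "0 < r"
  shows "cinner p (\<lambda>i. v i / complex_of_real (sqrt r)) (\<lambda>i. v i / complex_of_real (sqrt r)) = 1"
    and "proj p v i j = complex_of_real r * proj p (\<lambda>i. v i / complex_of_real (sqrt r)) i j"
proof -
  have r: "complex_of_real (sqrt r) * complex_of_real (sqrt r) = complex_of_real r"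
    using assms(2) by (simp flip: of_real_mult)
  have "cinner p (\<lambda>i. v i / complex_of_real (sqrt r)) (\<lambda>i. v i / complex_of_real (sqrt r))
      = cinner p v v / complex_of_real r"
    by (simp add: cinner_def sum_divide_distrib r)
  also have "\<dots> = 1" using assms by (simp add: cinner_self flip: of_real_sum)
  finally show "cinner p (\<lambda>i. v i / complex_of_real (sqrt r)) (\<lambda>i. v i / complex_of_real (sqrt r)) = 1" .
  show "proj p v i j = complex_of_real r * proj p (\<lambda>i. v i / complex_of_real (sqrt r)) i j"
    using assms(2) by (simp add: proj_def r)
qed

section \<open>Density matrices as mixtures of pure states\<close>

definition basis_state :: "nat \<Rightarrow> nat \<Rightarrow> cmatrix" where
  "basis_state p k = proj p (\<lambda>i. if i = k then 1 else 0)"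

lemma cinner_basis: "k < p \<Longrightarrow> cinner p (\<lambda>i. if i = k then 1 else 0) v = v k"
  by (simp add: cinner_def if_distrib[of cnj] if_distrib[of "\<lambda>x. x * _"] sum.delta cong: if_cong)

lemma basis_state_pure: "k < p \<Longrightarrow> basis_state p k \<in> pure p"
  by (auto simp: pure_def basis_state_def cinner_basis)

lemma K_eq_chull_pure: "K p = chull (pure p)"
proof
  show "chull (pure p) \<subseteq> K p"
    by (rule chull_subset[OF _ mixable_K]) (auto simp: pure_def proj_in_K)
  show "K p \<subseteq> chull (pure p)"
  proof
    fix A assume A: "A \<in> K p"
    then obtain u where u: "A = (\<lambda>i j. \<Sum>l<p. proj p (u l) i j)"
      using positive_op_sum_proj unfolding K_def by blast
    define r where "r l = (\<Sum>i<p. (cmod (u l i))\<^sup>2)" for l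
    \<comment> \<open>A zero vector cannot be normalised, but its weight \<open>r l\<close> is 0, so
      an arbitrary pure state may take its place.\<close>
    define x where "x l = (if r l = 0 then basis_state p 0
        else proj p (\<lambda>i. u l i / complex_of_real (sqrt (r l))))" for l
    have r0: "0 \<le> r l" for l by (simp add: r_def sum_nonneg)
    \<comment> \<open>Trace 1 excludes dimension 0, where there would be no pure state to fall back
      on.\<close>
    have "p \<noteq> 0" using A by (cases p) (auto simp: K_def mtrace_def)
    then have x: "x l \<in> pure p" for l
      using cinner_normalize(1)[of "u l" p "r l"] r0[of l] r_def[of l] basis_state_pure[of 0 p]
      by (auto simp: x_def pure_def)
    have coef: "proj p (u l) i j = complex_of_real (r l) * x l i j" for l i j
    proof (cases "r l = 0")
      case True
      then have "\<forall>i<p. u l i = 0"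
        unfolding r_def by (subst (asm) sum_nonneg_eq_0_iff) auto
      then show ?thesis using True by (simp add: proj_def)
    next
      case False
      then show ?thesis
        using cinner_normalize(2)[of "u l" p "r l"] r0[of l] r_def[of l] by (simp add: x_def)
    qed
    have "complex_of_real (\<Sum>l<p. r l) = (\<Sum>l<p. cinner p (u l) (u l))"
      by (simp add: r_def cinner_self)
    also have "\<dots> = (\<Sum>l<p. \<Sum>i<p. proj p (u l) i i)"
      by (simp add: cinner_def proj_def mult.commute)
    also have "\<dots> = mtrace p A"
      unfolding mtrace_def u by (rule sum.swap)
    also have "\<dots> = complex_of_real 1" using A by (simp add: K_def)
    finally have "(\<Sum>l<p. r l) = 1" by (simp only: of_real_eq_iff)
    then have "(\<lambda>i j. \<Sum>l<p. complex_of_real (r l) * x l i j) \<in> chull (pure p)"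
      by (intro chull_sum) (auto simp: r0 chull.base x)
    then show "A \<in> chull (pure p)" by (simp add: u coef)
  qed
qed

text \<open>Two basis vectors and their normalised sum: the corner entries 1, 0 and 1/2 tell the
  states apart. They are the three columns of the pigeonhole.\<close>

lemma three_pure_states:
  assumes "2 \<le> p"
  obtains x y z where "x \<in> pure p" "y \<in> pure p" "z \<in> pure p" "x \<noteq> y" "x \<noteq> z" "y \<noteq> z"
proof -
  let ?v = "\<lambda>i. (if i < 2 then 1 else 0) / complex_of_real (sqrt 2)"
  have sum2: "(\<Sum>i<p. if i < 2 then 1 else 0 :: real) = 2"
  proof -
    have "(\<Sum>i<p. if i < 2 then 1 else 0 :: real) = (\<Sum>i<(2::nat). 1)"
      using assms by (intro sum.mono_neutral_cong_right) auto
    then show ?thesis by simp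
  qed
  have "(\<Sum>i<p. (cmod (if i < 2 then 1 else 0))\<^sup>2) = (\<Sum>i<p. if i < 2 then 1 else 0 :: real)"
    by (intro sum.cong) auto
  then have "cinner p ?v ?v = 1"
    using cinner_normalize(1)[of "\<lambda>i. if i < 2 then 1 else 0" p 2] sum2 by simp
  then have "proj p ?v \<in> pure p" by (simp add: pure_def)
  moreover have "basis_state p 0 0 0 = 1" "basis_state p 1 0 0 = 0" "proj p ?v 0 0 = 1/2"
    using assms by (auto simp: basis_state_def proj_def simp flip: of_real_mult)
  then have "basis_state p 0 \<noteq> basis_state p 1" "basis_state p 0 \<noteq> proj p ?v"
    "basis_state p 1 \<noteq> proj p ?v" by auto
  ultimately show thesis
    using that[of "basis_state p 0" "basis_state p 1" "proj p ?v"] assms basis_state_pure by simp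
qed

text \<open>A unit vector in dimension one is a phase, which the projection forgets.\<close>

lemma pure_1_unique:
  assumes "x \<in> pure 1" "y \<in> pure 1" shows "x = y"
proof -
  have "x = basis_state 1 0" if "x \<in> pure 1" for x
    using that by (auto simp: pure_def basis_state_def proj_def cinner_def fun_eq_iff mult.commute)
  then show ?thesis using assms by metis
qed

text \<open>By the parallelogram law, the midpoint of the projections onto u and v is also a mixture of
  those onto u + v and u - v.\<close>

lemma pure_midpoint_other_mixture:
  assumes "x \<in> pure p" "y \<in> pure p" "x \<noteq> y"
  obtains z w t where "z \<in> pure p" "w \<in> pure p" "0 < t" "t < 1" "z \<noteq> x" "z \<noteq> y"
    "cconv (1/2) x y = cconv t z w"
proof -
  obtain u v where x: "x = proj p u" "cinner p u u = 1" and y: "y = proj p v" "cinner p v v = 1"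
    using assms by (auto simp: pure_def)
  let ?a = "\<lambda>i. u i + v i" and ?b = "\<lambda>i. u i - v i"
  define \<alpha> where "\<alpha> = (\<Sum>i<p. (cmod (?a i))\<^sup>2)"
  define \<beta> where "\<beta> = (\<Sum>i<p. (cmod (?b i))\<^sup>2)"
  \<comment> \<open>Distinct projections come from non-proportional vectors. This keeps u + v and u
    - v nonzero and prevents u + v from being parallel to either vector.\<close>
  have npar: "\<not> (\<forall>i<p. v i = c * u i)" for c
    using unit_parallel[OF y(2) x(2)] assms(3) x(1) y(1) by metis
  have npar': "\<not> (\<forall>i<p. u i = c * v i)" for c
    using unit_parallel[OF x(2) y(2)] assms(3) x(1) y(1) by metis
  have "\<alpha> \<noteq> 0"
  proof
    assume "\<alpha> = 0"
    then have "\<forall>i<p. u i + v i = 0"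
      unfolding \<alpha>_def by (subst (asm) sum_nonneg_eq_0_iff) auto
    then show False using npar[of "-1"] by (metis add_eq_0_iff mult_minus1)
  qed
  moreover have "\<beta> \<noteq> 0"
  proof
    assume "\<beta> = 0"
    then have "\<forall>i<p. u i - v i = 0"
      unfolding \<beta>_def by (subst (asm) sum_nonneg_eq_0_iff) auto
    then show False using npar[of 1] by simp
  qed
  moreover have "0 \<le> \<alpha>" "0 \<le> \<beta>" by (simp_all add: \<alpha>_def \<beta>_def sum_nonneg)
  ultimately have pos: "0 < \<alpha>" "0 < \<beta>" by auto
  have "\<alpha> + \<beta> = (\<Sum>i<p. 2 * (cmod (u i))\<^sup>2 + 2 * (cmod (v i))\<^sup>2)"
    unfolding \<alpha>_def \<beta>_def sum.distrib[symmetric]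
    by (intro sum.cong refl) (simp only: cmod_power2, simp add: power2_eq_square algebra_simps)
  also have "\<dots> = 2 * (\<Sum>i<p. (cmod (u i))\<^sup>2) + 2 * (\<Sum>i<p. (cmod (v i))\<^sup>2)"
    by (simp add: sum.distrib sum_distrib_left)
  also have "(\<Sum>i<p. (cmod (u i))\<^sup>2) = 1"
    using x(2) unfolding cinner_self by (simp only: of_real_eq_1_iff)
  also have "(\<Sum>i<p. (cmod (v i))\<^sup>2) = 1"
    using y(2) unfolding cinner_self by (simp only: of_real_eq_1_iff)
  finally have sum4: "\<beta> = 4 - \<alpha>" by simp
  let ?a' = "\<lambda>i. ?a i / complex_of_real (sqrt \<alpha>)"
  let ?b' = "\<lambda>i. ?b i / complex_of_real (sqrt \<beta>)"
  let ?z = "proj p ?a'" and ?w = "proj p ?b'"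
  note na = cinner_normalize[OF \<alpha>_def[symmetric] pos(1)]
  note nb = cinner_normalize[OF \<beta>_def[symmetric] pos(2)]
  have par: "\<exists>c. \<forall>i<p. u i + v i = c * g i" if "?z = proj p g" for g
  proof -
    have "\<forall>i<p. ?a' i = cinner p g ?a' * g i" using proj_eq_parallel[OF na(1) that] .
    then have "\<forall>i<p. u i + v i = (complex_of_real (sqrt \<alpha>) * cinner p g ?a') * g i"
      using pos(1) by (simp add: field_simps)
    then show ?thesis by blast
  qed
  have "?z \<noteq> x"
  proof
    assume "?z = x"
    then obtain c where "\<forall>i<p. u i + v i = c * u i" using par x(1) by blast
    then have "\<forall>i<p. v i = (c - 1) * u i" by (simp add: left_diff_distrib eq_diff_eq add.commute)
    then show False using npar by blast
  qed
  moreover have "?z \<noteq> y"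
  proof
    assume "?z = y"
    then obtain c where "\<forall>i<p. u i + v i = c * v i" using par y(1) by blast
    then have "\<forall>i<p. u i = (c - 1) * v i" by (simp add: left_diff_distrib eq_diff_eq add.commute)
    then show False using npar' by blast
  qed
  \<comment> \<open>Unnormalised, the matrices of u + v and u - v add up to twice the sum of those
    of u and v, and the squared norms \<alpha> and \<beta> add up to 4; hence the weights \<alpha>/4
    and \<beta>/4.\<close>
  moreover have "cconv (1/2) x y = cconv (\<alpha>/4) ?z ?w"
  proof (intro ext)
    fix i j
    have "cconv (\<alpha>/4) ?z ?w i j
        = (complex_of_real \<alpha> * ?z i j + complex_of_real \<beta> * ?w i j) / 4"
      by (simp add: cconv_def sum4 field_simps)
    also have "\<dots> = (proj p ?a i j + proj p ?b i j) / 4"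
      by (simp only: na(2) nb(2))
    also have "\<dots> = cconv (1/2) x y i j"
      by (simp add: cconv_def x(1) y(1) proj_def field_simps)
    finally show "cconv (1/2) x y i j = cconv (\<alpha>/4) ?z ?w i j" by simp
  qed
  moreover have "0 < \<alpha>/4" "\<alpha>/4 < 1" using pos sum4 by auto
  ultimately show thesis
    using that[of ?z ?w "\<alpha>/4"] na(1) nb(1) by (simp add: pure_def)
qed

section \<open>Separable states\<close>

lemma sum_div_mod:
  "(\<Sum>i<m * (n::nat). f (i div n) (i mod n)) = (\<Sum>i<m. \<Sum>k<n. f i k :: 'a::comm_monoid_add)"
proof (induction m)
  case (Suc m)
  have "(\<Sum>i<Suc m * n. f (i div n) (i mod n))
      = (\<Sum>i<m * n. f (i div n) (i mod n)) + (\<Sum>i=m*n..<m*n+n. f (i div n) (i mod n))"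
    by (simp add: lessThan_atLeast0 sum.atLeastLessThan_concat add.commute)
  also have "(\<Sum>i=m*n..<m*n+n. f (i div n) (i mod n)) = (\<Sum>k<n. f m k)"
    by (simp add: sum.shift_bounds_nat_ivl[of _ 0 "m*n" n, simplified add_0 add.commute]
        lessThan_atLeast0 add.commute)
  finally show ?case by (simp add: Suc.IH)
qed simp

definition tvec :: "nat \<Rightarrow> (nat \<Rightarrow> complex) \<Rightarrow> (nat \<Rightarrow> complex) \<Rightarrow> nat \<Rightarrow> complex" where
  "tvec n a b = (\<lambda>i. a (i div n) * b (i mod n))"

lemma quad_form_tensor:
  "quad_form (m * n) (tensor m n A B) (tvec n a b) = quad_form m A a * quad_form n B b"
proof -
  let ?f = "\<lambda>i k j l. cnj (a i * b k) * (A i j * B k l) * (a j * b l)"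
  have "quad_form (m * n) (tensor m n A B) (tvec n a b)
      = (\<Sum>i<m*n. \<Sum>j<m*n. ?f (i div n) (i mod n) (j div n) (j mod n))"
    unfolding quad_form_def tensor_def tvec_def by (intro sum.cong refl) simp
  also have "\<dots> = (\<Sum>i<m. \<Sum>k<n. \<Sum>j<m. \<Sum>l<n. ?f i k j l)"
    by (simp only: sum_div_mod[of "?f _ _"]
        sum_div_mod[of "\<lambda>i k. \<Sum>j<m. \<Sum>l<n. ?f i k j l"])
  also have "\<dots> = (\<Sum>i<m. \<Sum>k<n. (\<Sum>j<m. cnj (a i) * A i j * a j) * (\<Sum>l<n. cnj (b k) * B k l * b l))"
    by (simp add: sum_product mult_ac)
  also have "\<dots> = quad_form m A a * quad_form n B b"
    by (simp add: quad_form_def sum_product)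
  finally show ?thesis .
qed

lemma tensor_cconv_left: "tensor m n (cconv t A A') B = cconv t (tensor m n A B) (tensor m n A' B)"
  and tensor_cconv_right: "tensor m n A (cconv t B B') = cconv t (tensor m n A B) (tensor m n A B')"
  by (auto simp: tensor_def cconv_def fun_eq_iff algebra_simps)

section \<open>Partial traces and the swap\<close>

definition ptrace_right :: "nat \<Rightarrow> nat \<Rightarrow> cmatrix \<Rightarrow> cmatrix" where
  "ptrace_right m n r = (\<lambda>i j. if i < m \<and> j < m then \<Sum>k<n. r (i * n + k) (j * n + k) else 0)"

definition ptrace_left :: "nat \<Rightarrow> nat \<Rightarrow> cmatrix \<Rightarrow> cmatrix" where
  "ptrace_left m n r = (\<lambda>k l. if k < n \<and> l < n then \<Sum>i<m. r (i * n + k) (i * n + l) else 0)"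

text \<open>The dual of the flip automorphism, also for factors of different sizes: the index k*m +
  i of the flipped system reads the entry at i*n + k.\<close>

definition tswap :: "nat \<Rightarrow> nat \<Rightarrow> cmatrix \<Rightarrow> cmatrix" where
  "tswap m n r = (\<lambda>i j. if i < n * m \<and> j < n * m
     then r ((i mod m) * n + i div m) ((j mod m) * n + j div m) else 0)"

lemma pair_index_less:
  assumes "i < m" "k < (n::nat)" shows "i * n + k < m * n"
proof -
  have "i * n + k < Suc i * n" using assms by simp
  also have "\<dots> \<le> m * n" using assms by (intro mult_le_mono1) simp
  finally show ?thesis .
qed

lemma tensor_pair:
  "\<lbrakk>i < m; j < m; k < n; l < n\<rbrakk> \<Longrightarrow> tensor m n A B (i * n + k) (j * n + l) = A i j * B k l"
  by (simp add: tensor_def pair_index_less)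

lemma ptrace_right_tensor:
  assumes "A \<in> K m" "B \<in> K n" shows "ptrace_right m n (tensor m n A B) = A"
proof (intro ext)
  fix i j
  have "(\<Sum>k<n. B k k) = 1" using assms by (simp add: K_def mtrace_def)
  then show "ptrace_right m n (tensor m n A B) i j = A i j"
    using assms by (auto simp: ptrace_right_def tensor_pair K_def supported_def simp flip: sum_distrib_left)
qed

lemma ptrace_left_tensor:
  assumes "A \<in> K m" "B \<in> K n" shows "ptrace_left m n (tensor m n A B) = B"
proof (intro ext)
  fix i j
  have "(\<Sum>k<m. A k k) = 1" using assms by (simp add: K_def mtrace_def)
  then show "ptrace_left m n (tensor m n A B) i j = B i j"
    using assms by (auto simp: ptrace_left_def tensor_pair K_def supported_def simp flip: sum_distrib_right)
qed

text \<open>Since the factors have trace 1, partial traces recover them. The uniqueness of the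
  factor maps rests on this.\<close>

lemma tensor_eq_iff:
  assumes "A \<in> K m" "B \<in> K n" "A' \<in> K m" "B' \<in> K n"
  shows "tensor m n A B = tensor m n A' B' \<longleftrightarrow> A = A' \<and> B = B'"
  using assms ptrace_left_tensor ptrace_right_tensor by metis

lemma ptrace_right_cconv:
  "ptrace_right m n (cconv t r s) = cconv t (ptrace_right m n r) (ptrace_right m n s)"
  by (auto simp: ptrace_right_def cconv_def fun_eq_iff sum.distrib sum_distrib_left
      simp del: of_real_diff)

lemma ptrace_left_cconv:
  "ptrace_left m n (cconv t r s) = cconv t (ptrace_left m n r) (ptrace_left m n s)"
  by (auto simp: ptrace_left_def cconv_def fun_eq_iff sum.distrib sum_distrib_left
      simp del: of_real_diff)

lemma tswap_cconv: "tswap m n (cconv t r s) = cconv t (tswap m n r) (tswap m n s)"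
  by (auto simp: tswap_def cconv_def fun_eq_iff)

lemma tswap_tensor: "tswap m n (tensor m n A B) = tensor n m B A"
proof (intro ext)
  fix i j
  have "i div m < n" "i mod m < m" if "i < n * m" for i
    using that by (auto simp: less_mult_imp_div_less) (metis mod_less_divisor mult_0_right not_gr_zero not_less_zero)
  then show "tswap m n (tensor m n A B) i j = tensor n m B A i j"
    by (auto simp: tswap_def tensor_pair) (auto simp: tensor_def)
qed

section \<open>Separable states as the hull of pure products\<close>

definition pprod :: "nat \<Rightarrow> nat \<Rightarrow> cmatrix set" where
  "pprod m n = {tensor m n x y | x y. x \<in> pure m \<and> y \<in> pure n}"

lemma tensor_in_S:
  assumes "A \<in> K m" "B \<in> K n" shows "tensor m n A B \<in> S m n"
  unfolding S_def
  by (rule CollectI, rule exI[of _ 1], rule exI[of _ "\<lambda>_. 1"], rule exI[of _ "\<lambda>_. A"],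
      rule exI[of _ "\<lambda>_. B"]) (use assms in auto)

lemma mixable_S: "mixable (S m n)"
  unfolding mixable_def
proof (intro ballI allI impI)
  fix x y and t :: real
  assume x: "x \<in> S m n" and y: "y \<in> S m n" and t: "0 \<le> t \<and> t \<le> 1"
  obtain k c \<omega> \<sigma> where x': "\<forall>l<k. 0 \<le> c l \<and> \<omega> l \<in> K m \<and> \<sigma> l \<in> K n" "(\<Sum>l<(k::nat). c l) = (1::real)"
      "x = (\<lambda>i j. (\<Sum>l<k. complex_of_real (c l) * tensor m n (\<omega> l) (\<sigma> l) i j))"
    using x unfolding S_def by blast
  obtain k' c' \<omega>' \<sigma>' where y': "\<forall>l<k'. 0 \<le> c' l \<and> \<omega>' l \<in> K m \<and> \<sigma>' l \<in> K n"
      "(\<Sum>l<(k'::nat). c' l) = (1::real)"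
      "y = (\<lambda>i j. (\<Sum>l<k'. complex_of_real (c' l) * tensor m n (\<omega>' l) (\<sigma>' l) i j))"
    using y unfolding S_def by blast
  \<comment> \<open>The two families are concatenated, with weights scaled by \<open>t\<close> and
    \<open>1 - t\<close>; the index \<open>l - k\<close> restarts the second one.\<close>
  define d where "d l = (if l < k then t * c l else (1 - t) * c' (l - k))" for l
  define \<Omega> where "\<Omega> l = (if l < k then \<omega> l else \<omega>' (l - k))" for l
  define \<Sigma> where "\<Sigma> l = (if l < k then \<sigma> l else \<sigma>' (l - k))" for l
  have split: "(\<Sum>l<k+k'. f l) = (\<Sum>l<k. f l) + (\<Sum>l<k'. f (k + l))" for f :: "nat \<Rightarrow> 'b::comm_monoid_add"
    by (induction k') (simp_all add: add.assoc)
  have "\<forall>l<k+k'. 0 \<le> d l \<and> \<Omega> l \<in> K m \<and> \<Sigma> l \<in> K n"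
  proof (intro allI impI)
    fix l assume "l < k + k'"
    then show "0 \<le> d l \<and> \<Omega> l \<in> K m \<and> \<Sigma> l \<in> K n"
      using x'(1) y'(1)[rule_format, of "l - k"] t by (auto simp: d_def \<Omega>_def \<Sigma>_def)
  qed
  moreover have "(\<Sum>l<k+k'. d l) = 1"
    using x'(2) y'(2) by (simp add: split d_def flip: sum_distrib_left)
  moreover have "cconv t x y
      = (\<lambda>i j. (\<Sum>l<k+k'. complex_of_real (d l) * tensor m n (\<Omega> l) (\<Sigma> l) i j))"
    unfolding cconv_def x'(3) y'(3)
    by (simp add: split d_def \<Omega>_def \<Sigma>_def sum_distrib_left mult.assoc del: of_real_diff)
  ultimately show "cconv t x y \<in> S m n"
    unfolding S_def by blast
qed

text \<open>The tensor product is affine in each argument, so the factors are decomposed one after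
  the other.\<close>

lemma tensor_in_chull_pprod:
  assumes "A \<in> K m" "B \<in> K n" shows "tensor m n A B \<in> chull (pprod m n)"
  using assms(1) unfolding K_eq_chull_pure
proof (induction rule: chull.induct)
  case (base A)
  show ?case
    using assms(2) unfolding K_eq_chull_pure
    by (induction rule: chull.induct)
      (use base in \<open>auto simp: pprod_def tensor_cconv_right intro: chull.base chull.mix\<close>)
qed (simp add: tensor_cconv_left chull.mix)

lemma pure_in_K: "x \<in> pure p \<Longrightarrow> x \<in> K p"
  by (simp add: K_eq_chull_pure chull.base)

lemma S_eq_chull_pprod: "S m n = chull (pprod m n)"
proof
  show "chull (pprod m n) \<subseteq> S m n"
    by (rule chull_subset[OF _ mixable_S]) (auto simp: pprod_def tensor_in_S pure_in_K)
  show "S m n \<subseteq> chull (pprod m n)"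
    unfolding S_def by (auto intro!: chull_sum simp: tensor_in_chull_pprod)
qed

section \<open>Test forms at product vectors and the faces they cut out\<close>

definition pform :: "nat \<Rightarrow> nat \<Rightarrow> (nat \<Rightarrow> complex) \<Rightarrow> (nat \<Rightarrow> complex) \<Rightarrow> cmatrix \<Rightarrow> real" where
  "pform m n a b r = Re (quad_form (m * n) r (tvec n a b))"

lemma pform_cconv: "pform m n a b (cconv t r s) = t * pform m n a b r + (1 - t) * pform m n a b s"
  by (simp add: pform_def quad_form_cconv del: of_real_diff)

lemma pform_proj:
  "pform m n a b (tensor m n (proj m v) (proj n w)) = (cmod (cinner m a v) * cmod (cinner n b w))\<^sup>2"
  by (simp add: pform_def quad_form_tensor quad_form_proj power_mult_distrib flip: of_real_mult)

lemma pform_nonneg: "r \<in> S m n \<Longrightarrow> 0 \<le> pform m n a b r"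
  unfolding S_eq_chull_pprod
  by (induction rule: chull.induct) (auto simp: pprod_def pure_def pform_proj pform_cconv)

lemma pform_mix_eq_0:
  assumes "pform m n a b (cconv t r s) = 0" "r \<in> S m n" "s \<in> S m n" "0 < t" "t < 1"
  shows "pform m n a b r = 0" "pform m n a b s = 0"
proof -
  have "0 \<le> t * pform m n a b r" "0 \<le> (1 - t) * pform m n a b s"
    using assms pform_nonneg by simp_all
  then have "t * pform m n a b r = 0 \<and> (1 - t) * pform m n a b s = 0"
    using assms(1) unfolding pform_cconv by linarith
  then show "pform m n a b r = 0" "pform m n a b s = 0" using assms(4,5) by auto
qed

text \<open>Extremality and the facial structure of S are both read off from the zeros of the positive
  forms at product vectors alone.\<close>

lemma product_annihilator:
  assumes v: "cinner m v v = 1" "cinner m v' v' = 1" and w: "cinner n w w = 1" "cinner n w' w' = 1"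
    and ann: "\<And>a b. cinner m a v = 0 \<Longrightarrow> cinner n b w = 0 \<Longrightarrow> cinner m a v' = 0 \<or> cinner n b w' = 0"
  shows "proj m v' = proj m v \<or> proj n w' = proj n w"
proof (rule ccontr)
  assume "\<not> ?thesis"
  then obtain a b where "cinner m a v = 0" "cinner m a v' \<noteq> 0" "cinner n b w = 0" "cinner n b w' \<noteq> 0"
    using proj_eq_if_annihilated[OF v(2,1)] proj_eq_if_annihilated[OF w(2,1)] by blast
  then show False using ann by blast
qed

text \<open>For a generator the zeros fix both factors. A proper mixture is annihilated only if both
  ingredients are, so mixing adds nothing new.\<close>

lemma pprod_unique_if_annihilated:
  assumes v: "cinner m v v = 1" and w: "cinner n w w = 1"
    and r: "r \<in> chull (pprod m n)"
    and ann: "\<And>a b. cinner m a v = 0 \<or> cinner n b w = 0 \<Longrightarrow> pform m n a b r = 0"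
  shows "r = tensor m n (proj m v) (proj n w)"
  using r ann
proof (induction rule: chull.induct)
  case (base x)
  then obtain v' w' where x: "x = tensor m n (proj m v') (proj n w')"
      and v': "cinner m v' v' = 1" and w': "cinner n w' w' = 1"
    by (auto simp: pprod_def pure_def)
  have zero: "cinner m a v' = 0 \<or> cinner n b w' = 0" if "cinner m a v = 0 \<or> cinner n b w = 0" for a b
    using base(2)[OF that] by (simp add: x pform_proj)
  \<comment> \<open>With \<open>w'\<close> in the second slot, where the inner product is 1, the
    zero must come from the first factor.\<close>
  have "proj m v' = proj m v"
    by (rule proj_eq_if_annihilated[OF v' v]) (use zero[of _ w'] w' in auto)
  moreover have "proj n w' = proj n w"
    by (rule proj_eq_if_annihilated[OF w' w]) (use zero[of v'] v' in auto)
  ultimately show ?case using x by simp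
next
  case (mix x y t)
  show ?case
  proof (cases "t = 0 \<or> t = 1")
    case True
    then show ?thesis using mix by auto
  next
    case False
    then have t: "0 < t" "t < 1" using mix by auto
    have xy: "x \<in> S m n" "y \<in> S m n" using mix by (simp_all add: S_eq_chull_pprod)
    have "x = tensor m n (proj m v) (proj n w)"
      by (rule mix.IH(1)) (rule pform_mix_eq_0(1)[OF mix.prems xy t])
    moreover have "y = tensor m n (proj m v) (proj n w)"
      by (rule mix.IH(2)) (rule pform_mix_eq_0(2)[OF mix.prems xy t])
    ultimately show ?thesis by simp
  qed
qed

text \<open>If a pure product is a proper mixture, the ingredients inherit all its zeros and are
  therefore equal to it.\<close>

lemma extreme_S_iff: "extreme (S m n) x \<longleftrightarrow> x \<in> pprod m n"
proof
  assume "extreme (S m n) x"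
  then show "x \<in> pprod m n"
    unfolding S_eq_chull_pprod using extreme_chull_in_generators by (simp add: extreme_def)
next
  assume "x \<in> pprod m n"
  then obtain v w where x: "x = tensor m n (proj m v) (proj n w)"
      and v: "cinner m v v = 1" and w: "cinner n w w = 1"
    by (auto simp: pprod_def pure_def)
  have z: "pform m n a b x = 0" if "cinner m a v = 0 \<or> cinner n b w = 0" for a b
    using that by (auto simp: x pform_proj)
  show "extreme (S m n) x"
    unfolding extreme_def
  proof (intro conjI[OF _ ballI] ballI allI impI)
    show "x \<in> S m n" using \<open>x \<in> pprod m n\<close> by (simp add: S_eq_chull_pprod chull.base)
    fix y y' t assume y: "y \<in> S m n" "y' \<in> S m n" and t: "0 < t \<and> t < 1 \<and> x = cconv t y y'"
    have "pform m n a b y = 0 \<and> pform m n a b y' = 0" if "cinner m a v = 0 \<or> cinner n b w = 0" for a b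
      using pform_mix_eq_0[of m n a b t y y'] y t z[OF that] by simp
    then show "y = x \<and> y' = x"
      unfolding x using y pprod_unique_if_annihilated[OF v w] unfolding S_eq_chull_pprod by blast
  qed
qed

lemma linked_tensor_iff:
  assumes pure: "x \<in> pure m" "x' \<in> pure m" "y \<in> pure n" "y' \<in> pure n"
  shows "linked (S m n) (tensor m n x y) (tensor m n x' y') \<longleftrightarrow> x = x' \<or> y = y'"
proof
  assume l: "linked (S m n) (tensor m n x y) (tensor m n x' y')"
  show "x = x' \<or> y = y'"
  proof (rule ccontr)
    assume ne: "\<not> ?thesis"
    obtain v v' w w' where vw: "x = proj m v" "x' = proj m v'" "y = proj n w" "y' = proj n w'"
      "cinner m v v = 1" "cinner m v' v' = 1" "cinner n w w = 1" "cinner n w' w' = 1"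
      using pure by (auto simp: pure_def)
    have "tensor m n x y \<noteq> tensor m n x' y'"
      using ne pure by (simp add: tensor_eq_iff pure_in_K)
    then obtain z u t where z: "extreme (S m n) z" "z \<noteq> tensor m n x y" "z \<noteq> tensor m n x' y'"
        "u \<in> S m n" "0 < t" "t < 1"
        "cconv (1/2) (tensor m n x y) (tensor m n x' y') = cconv t z u"
      using l unfolding linked_def by blast
    then obtain v'' w'' where z': "z = tensor m n (proj m v'') (proj n w'')"
        and v'': "cinner m v'' v'' = 1" and w'': "cinner n w'' w'' = 1"
      by (auto simp: extreme_S_iff pprod_def pure_def)
    have zS: "z \<in> S m n" using z by (simp add: extreme_def)
    \<comment> \<open>Forms that vanish at both end points vanish at the midpoint, hence at its
      ingredient \<open>z\<close>.\<close>
    have zero: "cinner m a v'' = 0 \<or> cinner n b w'' = 0"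
      if "cinner m a v = 0 \<or> cinner n b w = 0" "cinner m a v' = 0 \<or> cinner n b w' = 0" for a b
    proof -
      have "pform m n a b (tensor m n x y) = 0" "pform m n a b (tensor m n x' y') = 0"
        using that by (auto simp: vw pform_proj)
      then have "pform m n a b (cconv t z u) = 0"
        by (simp add: pform_cconv flip: z(7))
      then have "pform m n a b z = 0" using pform_mix_eq_0(1) zS z by blast
      then show ?thesis by (simp add: z' pform_proj)
    qed
    \<comment> \<open>A first vector orthogonal to \<open>v\<close> kills one end point, a second
      vector orthogonal to \<open>w'\<close> the other. This crossed choice and its mirror image
      leave only the two end points for \<open>z\<close>, because both factors differ.\<close>
    have "proj m v'' = x \<or> proj n w'' = y'"
      unfolding vw by (rule product_annihilator) (use vw v'' w'' zero in auto)
    moreover have "proj m v'' = x' \<or> proj n w'' = y"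
      unfolding vw by (rule product_annihilator) (use vw v'' w'' zero in auto)
    ultimately show False using z(2,3) z' ne by auto
  qed
next
  assume eq: "x = x' \<or> y = y'"
  show "linked (S m n) (tensor m n x y) (tensor m n x' y')"
  proof (cases "x = x' \<and> y = y'")
    case True
    then show ?thesis by (simp add: linked_def)
  next
    case False
    then consider "x = x'" "y \<noteq> y'" | "x \<noteq> x'" "y = y'" using eq by blast
    then show ?thesis
    proof cases
      case 1
      obtain z w t where z: "z \<in> pure n" "w \<in> pure n" "0 < t" "t < 1" "z \<noteq> y" "z \<noteq> y'"
          "cconv (1/2) y y' = cconv t z w"
        using pure_midpoint_other_mixture[OF pure(3,4) 1(2)] .
      have "cconv (1/2) (tensor m n x y) (tensor m n x y') = cconv t (tensor m n x z) (tensor m n x w)"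
        by (simp only: z(7) flip: tensor_cconv_right)
      moreover have "extreme (S m n) (tensor m n x z)"
        using z pure by (auto simp: extreme_S_iff pprod_def)
      moreover have "tensor m n x z \<noteq> tensor m n x y" "tensor m n x z \<noteq> tensor m n x y'"
        "tensor m n x w \<in> S m n"
        using z pure by (simp_all add: tensor_eq_iff pure_in_K tensor_in_S)
      ultimately show ?thesis unfolding linked_def 1(1)[symmetric] using z(3,4) by blast
    next
      case 2
      obtain z w t where z: "z \<in> pure m" "w \<in> pure m" "0 < t" "t < 1" "z \<noteq> x" "z \<noteq> x'"
          "cconv (1/2) x x' = cconv t z w"
        using pure_midpoint_other_mixture[OF pure(1,2) 2(1)] .
      have "cconv (1/2) (tensor m n x y) (tensor m n x' y) = cconv t (tensor m n z y) (tensor m n w y)"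
        by (simp only: z(7) flip: tensor_cconv_left)
      moreover have "extreme (S m n) (tensor m n z y)"
        using z pure by (auto simp: extreme_S_iff pprod_def)
      moreover have "tensor m n z y \<noteq> tensor m n x y" "tensor m n z y \<noteq> tensor m n x' y"
        "tensor m n w y \<in> S m n"
        using z pure by (simp_all add: tensor_eq_iff pure_in_K tensor_in_S)
      ultimately show ?thesis unfolding linked_def 2(2)[symmetric] using z(3,4) by blast
    qed
  qed
qed

section \<open>Affine automorphisms\<close>

lemma affine_iso_comp:
  assumes f: "affine_iso C D f" and g: "affine_iso D E g"
  shows "affine_iso C E (g \<circ> f)"
proof -
  have "bij_betw (g \<circ> f) C E" using f g unfolding affine_iso_def by (blast intro: bij_betw_trans)
  then show ?thesis
    unfolding affine_iso_def by (simp add: affine_isoD(1,3)[OF f] affine_isoD(3)[OF g])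
qed

lemma tswap_tswap: "r \<in> S m n \<Longrightarrow> tswap n m (tswap m n r) = r"
  unfolding S_eq_chull_pprod
  by (induction rule: chull.induct) (auto simp: pprod_def tswap_tensor tswap_cconv)

lemma tswap_in_S: "r \<in> S m n \<Longrightarrow> tswap m n r \<in> S n m"
  unfolding S_eq_chull_pprod
proof (induction rule: chull.induct)
  case (base x)
  then show ?case by (intro chull.base) (force simp: pprod_def tswap_tensor)
qed (simp add: tswap_cconv chull.mix)

lemma affine_iso_tswap: "affine_iso (S m n) (S n m) (tswap m n)"
  unfolding affine_iso_def
  by (auto simp: tswap_cconv intro!: bij_betw_byWitness[where f' = "tswap n m"]
      simp: tswap_tswap tswap_in_S)

section \<open>From pure products to all product states\<close>

text \<open>Holding one factor at a pure state and tracing it out afterwards gives maps that are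
  affine because \<open>\<Phi>\<close> and the partial traces are. They extend \<open>f\<close> and
  \<open>g\<close>, and the product formula spreads by mixing in one factor at a time. The target
  system may have other dimensions, as the swapped case requires.\<close>

lemma affine_iso_product_extension:
  assumes \<Phi>: "affine_iso (S m n) (S m' n') \<Phi>" and x0: "x0 \<in> pure m" and y0: "y0 \<in> pure n"
    and fg: "\<And>x y. x \<in> pure m \<Longrightarrow> y \<in> pure n \<Longrightarrow> \<Phi> (tensor m n x y) = tensor m' n' (f x) (g y)"
    and f: "\<And>x. x \<in> pure m \<Longrightarrow> f x \<in> pure m'" and g: "\<And>y. y \<in> pure n \<Longrightarrow> g y \<in> pure n'"
  obtains \<psi>1 \<psi>2 where "affine_iso (K m) (K m') \<psi>1" "affine_iso (K n) (K n') \<psi>2"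
    "\<And>\<omega> \<sigma>. \<omega> \<in> K m \<Longrightarrow> \<sigma> \<in> K n \<Longrightarrow> \<Phi> (tensor m n \<omega> \<sigma>) = tensor m' n' (\<psi>1 \<omega>) (\<psi>2 \<sigma>)"
proof -
  define \<psi>1 where "\<psi>1 \<omega> = ptrace_right m' n' (\<Phi> (tensor m n \<omega> y0))" for \<omega>
  define \<psi>2 where "\<psi>2 \<sigma> = ptrace_left m' n' (\<Phi> (tensor m n x0 \<sigma>))" for \<sigma>
  note x0K = pure_in_K[OF x0] and y0K = pure_in_K[OF y0]
  have aff1: "\<psi>1 (cconv t a b) = cconv t (\<psi>1 a) (\<psi>1 b)"
    if "a \<in> K m" "b \<in> K m" "0 \<le> t" "t \<le> 1" for a b t
    using that y0K by (simp add: \<psi>1_def tensor_cconv_left affine_isoD(3)[OF \<Phi>] tensor_in_S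
        ptrace_right_cconv)
  have aff2: "\<psi>2 (cconv t a b) = cconv t (\<psi>2 a) (\<psi>2 b)"
    if "a \<in> K n" "b \<in> K n" "0 \<le> t" "t \<le> 1" for a b t
    using that x0K by (simp add: \<psi>2_def tensor_cconv_right affine_isoD(3)[OF \<Phi>] tensor_in_S
        ptrace_left_cconv)
  have pure1: "\<psi>1 x = f x" if "x \<in> pure m" for x
    using that y0 f g by (simp add: \<psi>1_def fg ptrace_right_tensor pure_in_K)
  have pure2: "\<psi>2 y = g y" if "y \<in> pure n" for y
    using that x0 f g by (simp add: \<psi>2_def fg ptrace_left_tensor pure_in_K)
  have into1: "\<psi>1 \<omega> \<in> K m'" if "\<omega> \<in> K m" for \<omega>
    using that unfolding K_eq_chull_pure
    by (induction rule: chull.induct)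
      (simp_all add: pure1 f chull.base aff1[unfolded K_eq_chull_pure] chull.mix)
  have into2: "\<psi>2 \<sigma> \<in> K n'" if "\<sigma> \<in> K n" for \<sigma>
    using that unfolding K_eq_chull_pure
    by (induction rule: chull.induct)
      (simp_all add: pure2 g chull.base aff2[unfolded K_eq_chull_pure] chull.mix)
  have half: "\<Phi> (tensor m n x \<sigma>) = tensor m' n' (\<psi>1 x) (\<psi>2 \<sigma>)" if x: "x \<in> pure m" and "\<sigma> \<in> K n" for x \<sigma>
    using that(2) unfolding K_eq_chull_pure
  proof (induction rule: chull.induct)
    case (base y)
    then show ?case using x by (simp add: fg pure1 pure2)
  next
    case (mix a b t)
    then have "a \<in> K n" "b \<in> K n" by (simp_all add: K_eq_chull_pure)
    then show ?case
      using mix pure_in_K[OF x]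
      by (simp add: tensor_cconv_right aff2 affine_isoD(3)[OF \<Phi>] tensor_in_S)
  qed
  have full: "\<Phi> (tensor m n \<omega> \<sigma>) = tensor m' n' (\<psi>1 \<omega>) (\<psi>2 \<sigma>)" if "\<omega> \<in> K m" and \<sigma>: "\<sigma> \<in> K n" for \<omega> \<sigma>
    using that(1) unfolding K_eq_chull_pure
  proof (induction rule: chull.induct)
    case (base x)
    then show ?case using half \<sigma> by simp
  next
    case (mix a b t)
    then have "a \<in> K m" "b \<in> K m" by (simp_all add: K_eq_chull_pure)
    then show ?case
      using mix \<sigma> by (simp add: tensor_cconv_left aff1 affine_isoD(3)[OF \<Phi>] tensor_in_S)
  qed
  \<comment> \<open>The inverse of \<open>\<Phi>\<close> also preserves extreme points, so every
    pure product of the target has a pure product as preimage.\<close>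
  have onto: "\<exists>x\<in>pure m. \<exists>y\<in>pure n. x' = f x \<and> y' = g y" if "x' \<in> pure m'" "y' \<in> pure n'" for x' y'
  proof -
    let ?r = "tensor m' n' x' y'"
    have "extreme (S m' n') ?r" using that by (auto simp: extreme_S_iff pprod_def)
    then have "extreme (S m n) (inv_into (S m n) \<Phi> ?r)"
      by (rule affine_iso_extreme[OF affine_iso_inv[OF \<Phi> mixable_S] mixable_S])
    then obtain x y where xy: "x \<in> pure m" "y \<in> pure n" "inv_into (S m n) \<Phi> ?r = tensor m n x y"
      by (auto simp: extreme_S_iff pprod_def)
    have "?r \<in> S m' n'" using that by (simp add: tensor_in_S pure_in_K)
    then have "?r = \<Phi> (inv_into (S m n) \<Phi> ?r)"
      using \<Phi> unfolding affine_iso_def by (metis bij_betw_inv_into_right)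
    then have "?r = tensor m' n' (f x) (g y)" using xy fg by simp
    then show ?thesis
      using xy that f g by (auto simp: tensor_eq_iff pure_in_K)
  qed
  have onto1: "\<exists>\<omega>\<in>K m. \<psi>1 \<omega> = z" if "z \<in> K m'" for z
    using that unfolding K_eq_chull_pure[of m']
  proof (induction rule: chull.induct)
    case (base x)
    then show ?case using onto[OF base g[OF y0]] pure1 pure_in_K by metis
  next
    case (mix a b t)
    then obtain a' b' where "a' \<in> K m" "\<psi>1 a' = a" "b' \<in> K m" "\<psi>1 b' = b" by blast
    then show ?case using mix mixable_K[of m] aff1 unfolding mixable_def by metis
  qed
  have onto2: "\<exists>\<sigma>\<in>K n. \<psi>2 \<sigma> = z" if "z \<in> K n'" for z
    using that unfolding K_eq_chull_pure[of n']
  proof (induction rule: chull.induct)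
    case (base y)
    then show ?case using onto[OF f[OF x0] base] pure2 pure_in_K by metis
  next
    case (mix a b t)
    then obtain a' b' where "a' \<in> K n" "\<psi>2 a' = a" "b' \<in> K n" "\<psi>2 b' = b" by blast
    then show ?case using mix mixable_K[of n] aff2 unfolding mixable_def by metis
  qed
  \<comment> \<open>The product formula moves the question to \<open>\<Phi>\<close>, whose
    injectivity is known, with \<open>y0\<close> as common second factor.\<close>
  have inj1: "inj_on \<psi>1 (K m)"
  proof (rule inj_onI)
    fix a b assume ab: "a \<in> K m" "b \<in> K m" "\<psi>1 a = \<psi>1 b"
    then have "\<Phi> (tensor m n a y0) = \<Phi> (tensor m n b y0)" using y0K full by simp
    then show "a = b" using ab y0K by (simp add: affine_isoD(2)[OF \<Phi>] tensor_in_S tensor_eq_iff)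
  qed
  have inj2: "inj_on \<psi>2 (K n)"
  proof (rule inj_onI)
    fix a b assume ab: "a \<in> K n" "b \<in> K n" "\<psi>2 a = \<psi>2 b"
    then have "\<Phi> (tensor m n x0 a) = \<Phi> (tensor m n x0 b)" using x0K full by simp
    then show "a = b" using ab x0K by (simp add: affine_isoD(2)[OF \<Phi>] tensor_in_S tensor_eq_iff)
  qed
  have "affine_iso (K m) (K m') \<psi>1"
    unfolding affine_iso_def bij_betw_def using inj1 aff1 into1 onto1 by blast
  moreover have "affine_iso (K n) (K n') \<psi>2"
    unfolding affine_iso_def bij_betw_def using inj2 aff2 into2 onto2 by blast
  ultimately show thesis using that full by blast
qed

section \<open>The dimension as an affine invariant\<close>

text \<open>Density matrices are bounded by the identity. For a projection this is Bessel's
  inequality, the defect being the squared norm of the component of \<open>a\<close> orthogonal to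
  \<open>v\<close>; mixing preserves the bound.\<close>

lemma Re_quad_form_le:
  assumes "z \<in> K p" shows "Re (quad_form p z a) \<le> Re (cinner p a a)"
  using assms unfolding K_eq_chull_pure
proof (induction rule: chull.induct)
  case (base z)
  then obtain v where z: "z = proj p v" and v: "cinner p v v = 1" by (auto simp: pure_def)
  let ?c = "cinner p v a"
  let ?b = "\<lambda>i. a i - ?c * v i"
  have "cinner p v ?b = 0" by (simp add: cinner_diff_scale_right v)
  then have "cinner p ?b v = 0" by (metis cinner_cnj complex_cnj_zero)
  then have "cinner p ?b ?b = cinner p ?b a" by (simp add: cinner_diff_scale_right)
  also have "\<dots> = cnj (cinner p a ?b)" by (simp only: cinner_cnj)
  also have "cinner p a ?b = cinner p a a - ?c * cnj ?c"
    by (simp add: cinner_diff_scale_right cinner_cnj)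
  also have "\<dots> = cinner p a a - complex_of_real ((cmod ?c)\<^sup>2)"
    by (simp only: complex_norm_square)
  finally have "Re (cinner p ?b ?b) = Re (cinner p a a) - (cmod ?c)\<^sup>2" by simp
  moreover have "0 \<le> Re (cinner p ?b ?b)" by (simp only: cinner_self Re_complex_of_real) (simp add: sum_nonneg)
  moreover have "cmod (cinner p a v) = cmod ?c" by (metis cinner_cnj complex_mod_cnj)
  ultimately show ?case by (simp add: z quad_form_proj)
next
  case (mix x y t)
  have "Re (quad_form p (cconv t x y) a) = t * Re (quad_form p x a) + (1 - t) * Re (quad_form p y a)"
    by (simp add: quad_form_cconv del: of_real_diff)
  also have "\<dots> \<le> t * Re (cinner p a a) + (1 - t) * Re (cinner p a a)"
    using mix by (intro add_mono mult_left_mono) auto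
  also have "\<dots> = Re (cinner p a a)" by (simp add: algebra_simps)
  finally show ?case .
qed

definition max_mixed :: "nat \<Rightarrow> cmatrix" where
  "max_mixed p = (\<lambda>i j. if i = j \<and> i < p then 1 / of_nat p else 0)"

text \<open>The complement is (I - z) / (p - 1), positive because \<open>z\<close> is bounded by the
  identity. In dimension one the denominator is 0, but there \<open>z\<close> is itself the
  maximally mixed state.\<close>

lemma max_mixed_mixture:
  assumes z: "z \<in> K p"
  obtains u where "u \<in> K p" "max_mixed p = cconv (1 / real p) z u"
proof (cases "p \<le> 1")
  case True
  have "p \<noteq> 0" using z by (cases p) (auto simp: K_def mtrace_def)
  then have p: "p = 1" using True by simp
  have "z i j = (if i = 0 \<and> j = 0 then 1 else 0)" for i j
    using z unfolding p by (cases "i = 0"; cases "j = 0") (auto simp: K_def supported_def mtrace_def)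
  then have "max_mixed p = z" by (auto simp: p max_mixed_def fun_eq_iff)
  then show thesis using that[OF z] p by simp
next
  case False
  define q where "q = real p - 1"
  have q: "0 < q" using False by (simp add: q_def)
  have qp: "of_nat p = complex_of_real q + 1" by (simp add: q_def)
  define u where "u i j = ((if i = j \<and> i < p then 1 else 0) - z i j) / complex_of_real q" for i j
  have "quad_form p u a = (cinner p a a - quad_form p z a) / complex_of_real q" for a
  proof -
    have "quad_form p u a = (\<Sum>i<p. \<Sum>j<p. (if i = j then cnj (a i) * a j else 0) / complex_of_real q
          - cnj (a i) * z i j * a j / complex_of_real q)"
      unfolding quad_form_def u_def
      by (intro sum.cong refl) (simp add: algebra_simps diff_divide_distrib)
    also have "\<dots> = (\<Sum>i<p. \<Sum>j<p. (if i = j then cnj (a i) * a j else 0)) / complex_of_real q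
        - quad_form p z a / complex_of_real q"
      by (simp add: sum_subtractf quad_form_def flip: sum_divide_distrib)
    finally show ?thesis by (simp add: cinner_def diff_divide_distrib)
  qed
  moreover have "quad_form p z a \<in> \<real>" for a using z by (simp add: K_def positive_op_def)
  moreover have "cinner p a a \<in> \<real>" for a by (simp only: cinner_self Reals_of_real)
  ultimately have "positive_op p u"
    unfolding positive_op_def using Re_quad_form_le[OF z] q
    by (auto intro!: Reals_divide Reals_diff)
  moreover have "supported p u" using z by (auto simp: u_def supported_def K_def)
  moreover have "mtrace p u = 1"
  proof -
    have "mtrace p u = (\<Sum>i<p. (1 - z i i) / complex_of_real q)"
      unfolding mtrace_def u_def by (intro sum.cong) auto
    also have "\<dots> = (of_nat p - mtrace p z) / complex_of_real q"
      by (simp add: mtrace_def sum_subtractf flip: sum_divide_distrib)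
    also have "\<dots> = 1" using z q by (simp add: K_def qp)
    finally show ?thesis .
  qed
  ultimately have "u \<in> K p" by (simp add: K_def)
  moreover have "max_mixed p = cconv (1 / real p) z u"
  proof (intro ext)
    fix i j
    have p0: "complex_of_real q + 1 \<noteq> 0" using q by (simp add: complex_eq_iff)
    have "complex_of_real (1 - 1 / real p) = complex_of_real q / (complex_of_real q + 1)"
      using p0 False by (simp add: qp[symmetric] q_def field_simps)
    moreover have "complex_of_real (1 / real p) = 1 / (complex_of_real q + 1)"
      by (simp add: qp)
    ultimately have "cconv (1 / real p) z u i j = (z i j + complex_of_real q * u i j) / (complex_of_real q + 1)"
      unfolding cconv_def by (simp only: add_divide_distrib) simp
    also have "complex_of_real q * u i j = (if i = j \<and> i < p then 1 else 0) - z i j"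
      using q by (simp add: u_def)
    finally show "max_mixed p i j = cconv (1 / real p) z u i j"
      by (simp add: max_mixed_def qp)
  qed
  ultimately show thesis using that by blast
qed

lemma max_mixed_in_K:
  assumes "1 \<le> p" shows "max_mixed p \<in> K p"
proof -
  have "basis_state p 0 \<in> K p" using assms by (intro pure_in_K basis_state_pure) simp
  then obtain u where "u \<in> K p" "max_mixed p = cconv (1 / real p) (basis_state p 0) u"
    using max_mixed_mixture by blast
  then show ?thesis
    using mixable_K[of p] \<open>basis_state p 0 \<in> K p\<close> assms by (auto simp: mixable_def)
qed

text \<open>The maximally mixed state dominates 1/m times every state, hence so does its image in K n,
  whose n diagonal entries are therefore at least 1/m while they sum to 1.\<close>

lemma affine_iso_K_le:
  assumes \<psi>: "affine_iso (K m) (K n) \<psi>" and m: "1 \<le> m"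
  shows "n \<le> m"
proof -
  define d where "d = \<psi> (max_mixed m)"
  have d: "d \<in> K n" using affine_isoD(1)[OF \<psi> max_mixed_in_K[OF m]] by (simp add: d_def)
  have "1 / real m \<le> Re (d j j)" if j: "j < n" for j
  proof -
    have "basis_state n j \<in> K n" using j by (intro pure_in_K basis_state_pure)
    then obtain z where z: "z \<in> K m" "\<psi> z = basis_state n j" using affine_isoD(4)[OF \<psi>] by blast
    obtain u where u: "u \<in> K m" "max_mixed m = cconv (1 / real m) z u"
      using max_mixed_mixture[OF z(1)] .
    have "d = cconv (1 / real m) (basis_state n j) (\<psi> u)"
      using z u m by (simp add: d_def affine_isoD(3)[OF \<psi>])
    then have "Re (d j j) = 1 / real m + (1 - 1 / real m) * Re (\<psi> u j j)"
      using j by (simp add: cconv_def basis_state_def proj_def)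
    moreover have "0 \<le> Re (\<psi> u j j)"
      using affine_isoD(1)[OF \<psi> u(1)] quad_form_basis[OF j, of "\<psi> u"]
      unfolding K_def positive_op_def by (metis (mono_tags, lifting) mem_Collect_eq)
    ultimately show ?thesis using m by simp
  qed
  then have "(\<Sum>j<n. 1 / real m) \<le> (\<Sum>j<n. Re (d j j))" by (intro sum_mono) simp
  also have "\<dots> = Re (mtrace n d)" by (simp add: mtrace_def)
  also have "\<dots> = 1" using d by (simp add: K_def)
  finally show ?thesis using m by (simp add: field_simps)
qed

section \<open>The dichotomy and uniqueness\<close>

text \<open>Partial traces read off the coordinates \<open>F\<close> and \<open>G\<close> of the
  image of a pure product, and invariance of \<open>linked\<close> makes them a collineation of the
  grid.\<close>

lemma affine_iso_S_cases:
  assumes m: "1 \<le> m" and n: "1 \<le> n" and \<Phi>: "affine_iso (S m n) (S m n) \<Phi>"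
  obtains (product) \<psi>1 \<psi>2 where "affine_iso (K m) (K m) \<psi>1" "affine_iso (K n) (K n) \<psi>2"
      "\<And>\<omega> \<sigma>. \<omega> \<in> K m \<Longrightarrow> \<sigma> \<in> K n \<Longrightarrow> \<Phi> (tensor m n \<omega> \<sigma>) = tensor m n (\<psi>1 \<omega>) (\<psi>2 \<sigma>)"
  | (swapped) \<psi>1 \<psi>2 where "m = n" "affine_iso (K m) (K m) \<psi>1" "affine_iso (K n) (K n) \<psi>2"
      "\<And>\<omega> \<sigma>. \<omega> \<in> K m \<Longrightarrow> \<sigma> \<in> K n \<Longrightarrow> \<Phi> (tensor m n \<omega> \<sigma>) = tensor n m (\<psi>2 \<sigma>) (\<psi>1 \<omega>)"
proof -
  define F where "F x y = ptrace_right m n (\<Phi> (tensor m n x y))" for x y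
  define G where "G x y = ptrace_left m n (\<Phi> (tensor m n x y))" for x y
  have FG: "F x y \<in> pure m \<and> G x y \<in> pure n \<and> \<Phi> (tensor m n x y) = tensor m n (F x y) (G x y)"
    if "x \<in> pure m" "y \<in> pure n" for x y
  proof -
    have "extreme (S m n) (tensor m n x y)" using that by (auto simp: extreme_S_iff pprod_def)
    then have "extreme (S m n) (\<Phi> (tensor m n x y))"
      by (rule affine_iso_extreme[OF \<Phi> mixable_S])
    then obtain x' y' where "x' \<in> pure m" "y' \<in> pure n" "\<Phi> (tensor m n x y) = tensor m n x' y'"
      by (auto simp: extreme_S_iff pprod_def)
    then show ?thesis
      by (simp add: F_def G_def ptrace_left_tensor ptrace_right_tensor pure_in_K)
  qed
  have inS: "tensor m n x y \<in> S m n" if "x \<in> pure m" "y \<in> pure n" for x y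
    using that by (simp add: tensor_in_S pure_in_K)
  have coll: "(F x y = F x' y' \<or> G x y = G x' y') \<longleftrightarrow> (x = x' \<or> y = y')"
    if "x \<in> pure m" "x' \<in> pure m" "y \<in> pure n" "y' \<in> pure n" for x x' y y'
  proof -
    have "F x y = F x' y' \<or> G x y = G x' y' \<longleftrightarrow>
        linked (S m n) (\<Phi> (tensor m n x y)) (\<Phi> (tensor m n x' y'))"
      using FG that linked_tensor_iff by simp
    also have "\<dots> \<longleftrightarrow> x = x' \<or> y = y'"
      using that by (simp add: affine_iso_linked_iff[OF \<Phi> mixable_S mixable_S] inS linked_tensor_iff)
    finally show ?thesis .
  qed
  have inj: "x = x' \<and> y = y'"
    if "x \<in> pure m" "x' \<in> pure m" "y \<in> pure n" "y' \<in> pure n" "F x y = F x' y'" "G x y = G x' y'"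
    for x x' y y'
  proof -
    have "\<Phi> (tensor m n x y) = \<Phi> (tensor m n x' y')" using FG that by simp
    then show ?thesis
      using that by (simp add: affine_isoD(2)[OF \<Phi>] inS tensor_eq_iff pure_in_K)
  qed
  obtain x0 y0 where x0: "x0 \<in> pure m" and y0: "y0 \<in> pure n"
    using basis_state_pure[of 0 m] basis_state_pure[of 0 n] m n by auto
  have "(\<forall>x\<in>pure m. \<forall>x'\<in>pure m. \<forall>y\<in>pure n. \<forall>y'\<in>pure n. F x y = F x y' \<and> G x y = G x' y) \<or>
        (\<forall>x\<in>pure m. \<forall>x'\<in>pure m. \<forall>y\<in>pure n. \<forall>y'\<in>pure n. G x y = G x y' \<and> F x y = F x' y)"
  proof (cases "m = 1 \<or> n = 1")
    \<comment> \<open>With a single pure state in one factor, the coordinate in that factor is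
      constant and the other one depends on a single argument.\<close>
    case True
    then show ?thesis
    proof
      assume "m = 1"
      then have "x = x'" if "x \<in> pure m" "x' \<in> pure m" for x x' using that pure_1_unique by simp
      then show ?thesis using FG by metis
    next
      assume "n = 1"
      then have "y = y'" if "y \<in> pure n" "y' \<in> pure n" for y y' using that pure_1_unique by simp
      then show ?thesis using FG by metis
    qed
  next
    case False
    then obtain a b c where "a \<in> pure n" "b \<in> pure n" "c \<in> pure n" "a \<noteq> b" "a \<noteq> c" "b \<noteq> c"
      using three_pure_states[of n] n by (metis One_nat_def Suc_1 le_antisym not_less_eq_eq)
    then show ?thesis
      using grid_collineation_product_or_swap[of "pure m" "pure n" F G a b c] coll inj by blast
  qed
  then show thesis
  proof
    assume *: "\<forall>x\<in>pure m. \<forall>x'\<in>pure m. \<forall>y\<in>pure n. \<forall>y'\<in>pure n. F x y = F x y' \<and> G x y = G x' y"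
    have eq: "\<Phi> (tensor m n x y) = tensor m n (F x y0) (G x0 y)" if "x \<in> pure m" "y \<in> pure n" for x y
      using FG[OF that] * that x0 y0 by metis
    show thesis
      by (rule affine_iso_product_extension[OF \<Phi> x0 y0, of "\<lambda>x. F x y0" "\<lambda>y. G x0 y"])
        (use eq FG x0 y0 product in blast)+
  next
    assume *: "\<forall>x\<in>pure m. \<forall>x'\<in>pure m. \<forall>y\<in>pure n. \<forall>y'\<in>pure n. G x y = G x y' \<and> F x y = F x' y"
    \<comment> \<open>Swapping the image turns this case into a product map with target
      \<open>S n m\<close>, so the same extension lemma applies.\<close>
    have \<Phi>': "affine_iso (S m n) (S n m) (tswap m n \<circ> \<Phi>)"
      by (rule affine_iso_comp[OF \<Phi> affine_iso_tswap])
    have eq: "(tswap m n \<circ> \<Phi>) (tensor m n x y) = tensor n m (G x y0) (F x0 y)"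
      if "x \<in> pure m" "y \<in> pure n" for x y
    proof -
      have "\<Phi> (tensor m n x y) = tensor m n (F x0 y) (G x y0)" using FG[OF that] * that x0 y0 by metis
      then show ?thesis by (simp add: tswap_tensor)
    qed
    obtain \<psi>1 \<psi>2 where \<psi>: "affine_iso (K m) (K n) \<psi>1" "affine_iso (K n) (K m) \<psi>2"
      "\<And>\<omega> \<sigma>. \<omega> \<in> K m \<Longrightarrow> \<sigma> \<in> K n \<Longrightarrow>
         (tswap m n \<circ> \<Phi>) (tensor m n \<omega> \<sigma>) = tensor n m (\<psi>1 \<omega>) (\<psi>2 \<sigma>)"
      by (rule affine_iso_product_extension[OF \<Phi>' x0 y0, of "\<lambda>x. G x y0" "\<lambda>y. F x0 y"])
        (use eq FG x0 y0 in blast)+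
    \<comment> \<open>\<open>\<psi>1\<close> leads from \<open>K m\<close> to \<open>K n\<close> and
      \<open>\<psi>2\<close> back; each yields one inequality.\<close>
    have mn: "m = n" using affine_iso_K_le[OF \<psi>(1) m] affine_iso_K_le[OF \<psi>(2) n] by simp
    have "\<Phi> (tensor m n \<omega> \<sigma>) = tensor n m (\<psi>2 \<sigma>) (\<psi>1 \<omega>)" if "\<omega> \<in> K m" "\<sigma> \<in> K n" for \<omega> \<sigma>
    proof -
      have "\<Phi> (tensor m n \<omega> \<sigma>) \<in> S m n"
        using that by (simp add: affine_isoD(1)[OF \<Phi>] tensor_in_S)
      then have "\<Phi> (tensor m n \<omega> \<sigma>) = tswap n m ((tswap m n \<circ> \<Phi>) (tensor m n \<omega> \<sigma>))"
        by (simp add: tswap_tswap)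
      also have "\<dots> = tensor m n (\<psi>2 \<sigma>) (\<psi>1 \<omega>)"
        by (simp only: \<psi>(3)[OF that] tswap_tensor)
      finally show ?thesis using mn by simp
    qed
    then show thesis using swapped \<psi>(1,2) mn by blast
  qed
qed

theorem mainTheorem9:
  fixes m n :: nat and \<Phi> :: "cmatrix \<Rightarrow> cmatrix"
  assumes "m \<ge> 1" and "n \<ge> 1"
    and "affine_aut (S m n) \<Phi>"
  shows "(m \<noteq> n \<longrightarrow>
           (\<exists>\<psi>1 \<psi>2. affine_aut (K m) \<psi>1 \<and> affine_aut (K n) \<psi>2 \<and>
              (\<forall>\<omega>\<in>K m. \<forall>\<sigma>\<in>K n. \<Phi> (tensor m n \<omega> \<sigma>) = tensor m n (\<psi>1 \<omega>) (\<psi>2 \<sigma>)) \<and>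
              (\<forall>\<psi>1' \<psi>2'. affine_aut (K m) \<psi>1' \<and> affine_aut (K n) \<psi>2' \<and>
                 (\<forall>\<omega>\<in>K m. \<forall>\<sigma>\<in>K n. \<Phi> (tensor m n \<omega> \<sigma>) = tensor m n (\<psi>1' \<omega>) (\<psi>2' \<sigma>))
                 \<longrightarrow> (\<forall>\<omega>\<in>K m. \<psi>1' \<omega> = \<psi>1 \<omega>) \<and> (\<forall>\<sigma>\<in>K n. \<psi>2' \<sigma> = \<psi>2 \<sigma>))))
       \<and> (m = n \<longrightarrow>
           (\<exists>\<psi>1 \<psi>2. affine_aut (K m) \<psi>1 \<and> affine_aut (K n) \<psi>2 \<and>
              (\<forall>\<omega>\<in>K m. \<forall>\<sigma>\<in>K n. \<Phi> (tensor m n \<omega> \<sigma>) = tensor m n (\<psi>1 \<omega>) (\<psi>2 \<sigma>)) \<and>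
              (\<forall>\<psi>1' \<psi>2'. affine_aut (K m) \<psi>1' \<and> affine_aut (K n) \<psi>2' \<and>
                 (\<forall>\<omega>\<in>K m. \<forall>\<sigma>\<in>K n. \<Phi> (tensor m n \<omega> \<sigma>) = tensor m n (\<psi>1' \<omega>) (\<psi>2' \<sigma>))
                 \<longrightarrow> (\<forall>\<omega>\<in>K m. \<psi>1' \<omega> = \<psi>1 \<omega>) \<and> (\<forall>\<sigma>\<in>K n. \<psi>2' \<sigma> = \<psi>2 \<sigma>)))
         \<or> (\<exists>\<psi>1 \<psi>2. affine_aut (K m) \<psi>1 \<and> affine_aut (K n) \<psi>2 \<and>
              (\<forall>\<omega>\<in>K m. \<forall>\<sigma>\<in>K n. \<Phi> (tensor m n \<omega> \<sigma>) = tensor n m (\<psi>2 \<sigma>) (\<psi>1 \<omega>)) \<and>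
              (\<forall>\<psi>1' \<psi>2'. affine_aut (K m) \<psi>1' \<and> affine_aut (K n) \<psi>2' \<and>
                 (\<forall>\<omega>\<in>K m. \<forall>\<sigma>\<in>K n. \<Phi> (tensor m n \<omega> \<sigma>) = tensor n m (\<psi>2' \<sigma>) (\<psi>1' \<omega>))
                 \<longrightarrow> (\<forall>\<omega>\<in>K m. \<psi>1' \<omega> = \<psi>1 \<omega>) \<and> (\<forall>\<sigma>\<in>K n. \<psi>2' \<sigma> = \<psi>2 \<sigma>))))"
proof -
  note m = \<open>m \<ge> 1\<close> and n = \<open>n \<ge> 1\<close>
  have mem: "\<psi> \<omega> \<in> K p" if "affine_aut (K p) \<psi>" "\<omega> \<in> K p" for p \<psi> \<omega>
    using that affine_isoD(1) by (simp add: affine_aut_iff_iso)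
  \<comment> \<open>Two factor maps are compared through their tensor products, so a state of either
    system needs a partner in the other one.\<close>
  obtain \<omega>0 \<sigma>0 where K0: "\<omega>0 \<in> K m" "\<sigma>0 \<in> K n" using max_mixed_in_K m n by blast
  have \<Phi>: "affine_iso (S m n) (S m n) \<Phi>" using assms(3) by (simp add: affine_aut_iff_iso)
  show ?thesis
    using m n \<Phi>
  proof (cases rule: affine_iso_S_cases)
    case (product \<psi>1 \<psi>2)
    have aut: "affine_aut (K m) \<psi>1" "affine_aut (K n) \<psi>2"
      using product by (simp_all add: affine_aut_iff_iso)
    have "(\<forall>\<omega>\<in>K m. \<psi>1' \<omega> = \<psi>1 \<omega>) \<and> (\<forall>\<sigma>\<in>K n. \<psi>2' \<sigma> = \<psi>2 \<sigma>)"
      if aut': "affine_aut (K m) \<psi>1'" "affine_aut (K n) \<psi>2'"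
        and eq: "\<forall>\<omega>\<in>K m. \<forall>\<sigma>\<in>K n. \<Phi> (tensor m n \<omega> \<sigma>) = tensor m n (\<psi>1' \<omega>) (\<psi>2' \<sigma>)" for \<psi>1' \<psi>2'
    proof -
      have "\<psi>1' \<omega> = \<psi>1 \<omega> \<and> \<psi>2' \<sigma> = \<psi>2 \<sigma>" if *: "\<omega> \<in> K m" "\<sigma> \<in> K n" for \<omega> \<sigma>
      proof -
        have "tensor m n (\<psi>1' \<omega>) (\<psi>2' \<sigma>) = tensor m n (\<psi>1 \<omega>) (\<psi>2 \<sigma>)"
          using * eq product(3) by metis
        then show ?thesis
          using tensor_eq_iff mem[OF aut(1) *(1)] mem[OF aut(2) *(2)] mem[OF aut'(1) *(1)] mem[OF aut'(2) *(2)]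
          by blast
      qed
      then show ?thesis using K0 by blast
    qed
    then have "\<exists>\<psi>1 \<psi>2. affine_aut (K m) \<psi>1 \<and> affine_aut (K n) \<psi>2 \<and>
        (\<forall>\<omega>\<in>K m. \<forall>\<sigma>\<in>K n. \<Phi> (tensor m n \<omega> \<sigma>) = tensor m n (\<psi>1 \<omega>) (\<psi>2 \<sigma>)) \<and>
        (\<forall>\<psi>1' \<psi>2'. affine_aut (K m) \<psi>1' \<and> affine_aut (K n) \<psi>2' \<and>
           (\<forall>\<omega>\<in>K m. \<forall>\<sigma>\<in>K n. \<Phi> (tensor m n \<omega> \<sigma>) = tensor m n (\<psi>1' \<omega>) (\<psi>2' \<sigma>))
           \<longrightarrow> (\<forall>\<omega>\<in>K m. \<psi>1' \<omega> = \<psi>1 \<omega>) \<and> (\<forall>\<sigma>\<in>K n. \<psi>2' \<sigma> = \<psi>2 \<sigma>))"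
      using aut product(3) by (intro exI[of _ \<psi>1] exI[of _ \<psi>2] conjI allI impI) blast+
    then show ?thesis by (intro conjI impI disjI1)
  next
    case (swapped \<psi>1 \<psi>2)
    have aut: "affine_aut (K m) \<psi>1" "affine_aut (K n) \<psi>2"
      using swapped by (simp_all add: affine_aut_iff_iso)
    have "(\<forall>\<omega>\<in>K m. \<psi>1' \<omega> = \<psi>1 \<omega>) \<and> (\<forall>\<sigma>\<in>K n. \<psi>2' \<sigma> = \<psi>2 \<sigma>)"
      if aut': "affine_aut (K m) \<psi>1'" "affine_aut (K n) \<psi>2'"
        and eq: "\<forall>\<omega>\<in>K m. \<forall>\<sigma>\<in>K n. \<Phi> (tensor m n \<omega> \<sigma>) = tensor n m (\<psi>2' \<sigma>) (\<psi>1' \<omega>)" for \<psi>1' \<psi>2'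
    proof -
      have "\<psi>1' \<omega> = \<psi>1 \<omega> \<and> \<psi>2' \<sigma> = \<psi>2 \<sigma>" if *: "\<omega> \<in> K m" "\<sigma> \<in> K n" for \<omega> \<sigma>
      proof -
        have "tensor n m (\<psi>2' \<sigma>) (\<psi>1' \<omega>) = tensor n m (\<psi>2 \<sigma>) (\<psi>1 \<omega>)"
          using * eq swapped(4) by metis
        then show ?thesis
          using tensor_eq_iff mem[OF aut(1) *(1)] mem[OF aut(2) *(2)] mem[OF aut'(1) *(1)] mem[OF aut'(2) *(2)]
          by blast
      qed
      then show ?thesis using K0 by blast
    qed
    then have "\<exists>\<psi>1 \<psi>2. affine_aut (K m) \<psi>1 \<and> affine_aut (K n) \<psi>2 \<and>
        (\<forall>\<omega>\<in>K m. \<forall>\<sigma>\<in>K n. \<Phi> (tensor m n \<omega> \<sigma>) = tensor n m (\<psi>2 \<sigma>) (\<psi>1 \<omega>)) \<and>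
        (\<forall>\<psi>1' \<psi>2'. affine_aut (K m) \<psi>1' \<and> affine_aut (K n) \<psi>2' \<and>
           (\<forall>\<omega>\<in>K m. \<forall>\<sigma>\<in>K n. \<Phi> (tensor m n \<omega> \<sigma>) = tensor n m (\<psi>2' \<sigma>) (\<psi>1' \<omega>))
           \<longrightarrow> (\<forall>\<omega>\<in>K m. \<psi>1' \<omega> = \<psi>1 \<omega>) \<and> (\<forall>\<sigma>\<in>K n. \<psi>2' \<sigma> = \<psi>2 \<sigma>))"
      using aut swapped(4) by (intro exI[of _ \<psi>1] exI[of _ \<psi>2] conjI allI impI) blast+
    then show ?thesis
      \<comment> \<open>The swapped case carries \<open>m = n\<close>, which makes the part for
        different dimensions vacuous.\<close>
      by (intro conjI impI disjI2) (rule notE[OF _ swapped(1)])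
  qed
qed

end
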